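(* Let $n\ge 2$, $m\ge 1$, $t=n+m$, and let $H$ be the symmetric $t\times t$ matrix of nonnegative integers \[ H=\begin{bmatrix} P & D\\ D^{T} & C\end{bmatrix}, \] where $P$ is the $n\times n$ matrix with diagonal entries $\alpha_1,\ldots,\alpha_n$ and all off-diagonal entries $b$; $D=[d_{i,j}]$ is $n\times m$; and $C$ is the symmetric $m\times m$ matrix with diagonal entries $\beta_1,\ldots,\beta_m$ and off-diagonal entries $c_{i,j}=c_{j,i}$ ($i\ne j$). Assume: (a) for all $i\in[n]$, $j\in[m]$: $\alpha_i\ge b\ge1$, $b\ge d_{i,j}\ge0$, $\beta_j\ge1$ and $\beta_j\ge d_{i,j}$; (b) for all distinct $i,j\in[m]$: $\beta_i\ge c_{i,j}$ and $b\ge c_{i,j}$; (c) for distinct $i,j\in[n]$: $\alpha_i>b$ or $\alpha_j>b$; (d) for distinct $i,j\in[m]$: $\beta_i>c_{i,j}$ or $\beta_j>c_{i,j}$; (e) for $i\in[n]$, $j\in[m]$: $\alpha_i>d_{i,j}$ or $\beta_j>d_{i,j}$; (f) for each $j\in[m]$ there exists $i\in[n]$ with $d_{i,j}\ne b$. Suppose $H$ is positive semidefinite. If $\dim_{\mathbb{K}}(R_t/\mathcal{J}_H)=\det H$, then for each $1\le l\le m$ we have $d_{r,l}=d_{s,l}$ for all $1\le r,s\le n$.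
   Context: $\mathbb{K}$ is a field and $R_t=\mathbb{K}[x_1,\ldots,x_t]$. For a symmetric $t\times t$ matrix $H=[h_{p,q}]$ of nonnegative integers with $h_{p,p}\ge \max_{q\ne p}h_{p,q}$ for all $p$, write $\gamma_p=h_{p,p}$ and define the monomial ideal $\mathcal{J}_H=\left\langle x_p^{\gamma_p},\ x_p^{\gamma_p-h_{p,q}}x_q^{\gamma_q-h_{p,q}}\mid 1\le p\le t,\ 1\le p<q\le t\right\rangle\subseteq R_t$. *)

theory Defs
  imports
    "HOL-Library.Poly_Mapping"
    "HOL-Algebra.QuotRing"
    "Jordan_Normal_Form.VS_Connect"
    "Jordan_Normal_Form.Determinant"
begin

text \<open>Variables are indexed from \<open>0\<close>: the polynomial ring in \<open>t\<close> variables consists of the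
  finitely supported maps from exponent vectors to coefficients whose monomials involve only
  variables with index below \<open>t\<close>.\<close>

type_synonym 'k mpoly = "(nat \<Rightarrow>\<^sub>0 nat) \<Rightarrow>\<^sub>0 'k"

definition Var :: "nat \<Rightarrow> 'k::field mpoly" where
  "Var p = Poly_Mapping.single (Poly_Mapping.single p 1) 1"

definition Const :: "'k::field \<Rightarrow> 'k mpoly" where
  "Const a = Poly_Mapping.single 0 a"

definition poly_ring :: "nat \<Rightarrow> 'k::field mpoly ring" where
  "poly_ring t =
    class_ring\<lparr>carrier :=
      {f. \<forall>\<mu>\<in>Poly_Mapping.keys f. Poly_Mapping.keys \<mu> \<subseteq> {..<t}}\<rparr>"

text \<open>The subtractions in the exponents do not truncate when each diagonal entry of \<open>H\<close> is maximal
  in its row.\<close>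

definition J_gens :: "nat mat \<Rightarrow> 'k::field mpoly set" where
  "J_gens H =
    {Var p ^ (H $$ (p, p)) | p. p < dim_row H} \<union>
    {Var p ^ (H $$ (p, p) - H $$ (p, q)) * Var q ^ (H $$ (q, q) - H $$ (p, q)) | p q.
       p < q \<and> q < dim_row H}"

definition J_ideal :: "nat mat \<Rightarrow> 'k::field mpoly set" where
  "J_ideal H = Idl\<^bsub>poly_ring (dim_row H)\<^esub> (J_gens H)"

text \<open>A quotient of the polynomial ring as a vector space over the coefficient field; a scalar acts
  as multiplication by its residue class.\<close>

definition quot_space ::
  "nat \<Rightarrow> 'k::field mpoly set \<Rightarrow> ('k, 'k mpoly set) module" where
  "quot_space t J =
    \<lparr>carrier = carrier (poly_ring t Quot J),
     monoid.mult = monoid.mult (poly_ring t Quot J),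
     one = one (poly_ring t Quot J),
     zero = zero (poly_ring t Quot J),
     add = add (poly_ring t Quot J),
     smult = (\<lambda>a X. (J +>\<^bsub>poly_ring t\<^esub> Const a) \<otimes>\<^bsub>poly_ring t Quot J\<^esub> X)\<rparr>"

definition pos_semidef :: "nat \<Rightarrow> real mat \<Rightarrow> bool" where
  "pos_semidef t A \<longleftrightarrow>
    A \<in> carrier_mat t t \<and> transpose_mat A = A \<and>
    (\<forall>v\<in>carrier_vec t. 0 \<le> v \<bullet> (A *\<^sub>v v))"

end

theory Submission
  imports Defs
begin

text \<open>The dimension is the number \<open>N H\<close> of monomials outside the monomial ideal, and \<open>det H \<le> N H\<close> holds
  for every positive semidefinite \<open>H\<close> whose diagonal entries are maximal in their rows. To see this by
  induction on the size, let \<open>b = h r s\<close> be the largest off-diagonal entry, \<open>M\<close> the block of the remaining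
  indices, and \<open>B\<^sub>r\<close>, \<open>B\<^sub>s\<close> the blocks on \<open>r\<close> resp. \<open>s\<close> and the remaining indices with \<open>h r r\<close> resp.
  \<open>h s s\<close> lowered to \<open>b\<close>. With \<open>\<delta>\<^sub>r = h r r - b\<close> and \<open>\<delta>\<^sub>s = h s s - b\<close>, counting gives
  \<open>N H \<ge> \<delta>\<^sub>r \<delta>\<^sub>s N M + \<delta>\<^sub>s N B\<^sub>r + \<delta>\<^sub>r N B\<^sub>s\<close>. If \<open>M\<close> is singular, so is \<open>H\<close>; otherwise a Schur
  complement expresses \<open>det H\<close> as \<open>\<delta>\<^sub>r \<delta>\<^sub>s det M + \<delta>\<^sub>s det B\<^sub>r + \<delta>\<^sub>r det B\<^sub>s\<close> plus a \<open>2 \<times> 2\<close> minor times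
  \<open>det M\<close>. That minor is nonpositive when \<open>B\<^sub>r\<close> and \<open>B\<^sub>s\<close> are positive semidefinite, and negative if rows
  \<open>r\<close> and \<open>s\<close> differ off \<open>{r, s}\<close>; the other cases follow by dropping \<open>B\<^sub>r\<close> or \<open>B\<^sub>s\<close>. Hence \<open>det H < N H\<close>
  if these rows differ and \<open>N H > 0\<close>, which applies to any two of the first \<open>n\<close> indices.\<close>

section \<open>Determinants of principal submatrices\<close>

text \<open>Indexing by a list of arbitrary labels allows rows and columns to be added, dropped or
  reordered without renumbering the others.\<close>

definition mat_on :: "('a \<Rightarrow> 'a \<Rightarrow> 'b) \<Rightarrow> 'a list \<Rightarrow> 'b mat" where
  "mat_on h xs = mat (length xs) (length xs) (\<lambda>(i, j). h (xs ! i) (xs ! j))"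

lemma mat_on_carrier [simp]: "mat_on h xs \<in> carrier_mat (length xs) (length xs)"
  by (simp add: mat_on_def)

lemma mat_on_cong:
  assumes "\<And>p q. p \<in> set xs \<Longrightarrow> q \<in> set xs \<Longrightarrow> h p q = h' p q"
  shows "mat_on h xs = mat_on h' xs"
  using assms by (auto simp: mat_on_def intro!: eq_matI)

text \<open>The same permutation acts on rows and on columns, so its sign enters twice and
  cancels.\<close>

lemma det_mat_on_mset:
  fixes h :: "'a \<Rightarrow> 'a \<Rightarrow> 'b::comm_ring_1"
  assumes "mset xs = mset ys"
  shows "det (mat_on h xs) = det (mat_on h ys)"
proof -
  define n where "n = length ys"
  obtain p where p: "p permutes {..<length ys}" and xs: "permute_list p ys = xs"
    using assms by (metis mset_eq_permutation)
  have p': "p permutes {0..<n}"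
    using p by (simp add: n_def atLeast0LessThan)
  have len: "length xs = n" using xs by (auto simp: n_def)
  have nth: "xs ! i = ys ! p i" if "i < n" for i
    using that xs p by (auto simp: n_def permute_list_nth)
  have pn: "p i < n" if "i < n" for i
    using that p' permutes_in_image by fastforce
  define A where "A = mat_on h ys"
  have A: "A \<in> carrier_mat n n" by (simp add: A_def n_def)
  define B where "B = mat n n (\<lambda>(i, j). A $$ (p i, j))"
  have B: "B \<in> carrier_mat n n" by (simp add: B_def)
  \<comment> \<open>\<open>B\<close> has only its rows permuted; transposing turns the permutation
    of the columns into a second one of rows.\<close>
  have "mat_on h xs = (mat n n (\<lambda>(i, j). B\<^sup>T $$ (p i, j)))\<^sup>T"
    by (rule eq_matI) (auto simp: mat_on_def B_def A_def len nth pn n_def[symmetric])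
  then have "det (mat_on h xs) = det (mat n n (\<lambda>(i, j). B\<^sup>T $$ (p i, j)))"
    by (simp add: det_transpose[of _ n])
  also have "\<dots> = signof p * det (B\<^sup>T)"
    using B by (intro det_permute_rows p') auto
  also have "det (B\<^sup>T) = signof p * det A"
    using det_permute_rows[OF A p'] det_transpose[OF B] by (simp add: B_def)
  finally show ?thesis
    by (simp add: A_def sign_def)
qed

lemma sum_nth_distinct:
  assumes "distinct xs"
  shows "(\<Sum>i = 0..<length xs. f (xs ! i)) = sum f (set xs)"
  using sum.reindex_bij_betw[OF bij_betw_nth[OF assms refl refl], of f]
  by (simp add: atLeast0LessThan)

text \<open>Turns a vector indexed by positions into a function on labels, which is well defined
  because no label repeats.\<close>

lemma ex_fun_nth:
  assumes "distinct xs"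
  shows "\<exists>f. \<forall>i<length xs. f (xs ! i) = g i"
proof -
  have "bij_betw (\<lambda>i. xs ! i) {..<length xs} (set xs)"
    using assms by (simp add: bij_betw_nth)
  then show ?thesis
    by (intro exI[of _ "\<lambda>x. g (inv_into {..<length xs} (\<lambda>i. xs ! i) x)"])
      (auto simp: bij_betw_inv_into_left)
qed

section \<open>Linear systems and Schur complements\<close>

text \<open>The inverse matrix applied to \<open>k\<close>, read as a function on labels. The
  coefficients \<open>w\<close> of the Schur complements come from here.\<close>

lemma mat_on_solvable:
  fixes h :: "'a \<Rightarrow> 'a \<Rightarrow> 'b::field"
  assumes "distinct xs" and "det (mat_on h xs) \<noteq> 0"
  shows "\<exists>w. \<forall>p\<in>set xs. (\<Sum>q\<in>set xs. h p q * w q) = k p"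
proof -
  let ?n = "length xs" and ?A = "mat_on h xs"
  obtain B where B: "B \<in> carrier_mat ?n ?n" and AB: "?A * B = 1\<^sub>m ?n"
    using det_non_zero_imp_unit[OF mat_on_carrier assms(2), where b = "()"]
    by (auto simp: Units_def ring_mat_def)
  define kv where "kv = vec ?n (\<lambda>i. k (xs ! i))"
  have kv: "kv \<in> carrier_vec ?n" by (simp add: kv_def)
  define v where "v = B *\<^sub>v kv"
  have v: "v \<in> carrier_vec ?n" using B kv by (simp add: v_def)
  have "?A *\<^sub>v v = kv"
    using AB kv B by (simp add: v_def flip: assoc_mult_mat_vec[of _ ?n ?n _ ?n])
  then have Av: "(\<Sum>j = 0..<?n. h (xs ! i) (xs ! j) * v $ j) = k (xs ! i)" if "i < ?n" for i
  proof -
    have "(?A *\<^sub>v v) $ i = kv $ i" by (simp add: \<open>?A *\<^sub>v v = kv\<close>)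
    then show ?thesis using that v by (simp add: mat_on_def kv_def scalar_prod_def)
  qed
  obtain w where w: "\<And>i. i < ?n \<Longrightarrow> w (xs ! i) = v $ i"
    using ex_fun_nth[OF assms(1)] by metis
  have "(\<Sum>q\<in>set xs. h (xs ! i) q * w q) = k (xs ! i)" if "i < ?n" for i
    using Av[OF that] w by (simp flip: sum_nth_distinct[OF assms(1)])
  then show ?thesis
    by (metis in_set_conv_nth)
qed

lemma det_mat_on_eq_0_iff:
  fixes h :: "'a \<Rightarrow> 'a \<Rightarrow> 'b::field"
  assumes "distinct xs"
  shows "det (mat_on h xs) = 0 \<longleftrightarrow>
    (\<exists>v. (\<exists>p\<in>set xs. v p \<noteq> 0) \<and> (\<forall>p\<in>set xs. (\<Sum>q\<in>set xs. h p q * v q) = 0))"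
proof -
  let ?n = "length xs" and ?A = "mat_on h xs"
  have mult: "(?A *\<^sub>v v) $ i = (\<Sum>q\<in>set xs. h (xs ! i) q * w q)"
    if "v \<in> carrier_vec ?n" "i < ?n" "\<And>i. i < ?n \<Longrightarrow> w (xs ! i) = v $ i" for v w i
    using that by (simp add: mat_on_def scalar_prod_def flip: sum_nth_distinct[OF assms])
  show ?thesis
    unfolding det_0_iff_vec_prod_zero_field[OF mat_on_carrier]
  proof (intro iffI; elim exE conjE)
    fix v assume v: "v \<in> carrier_vec ?n" "v \<noteq> 0\<^sub>v ?n" "?A *\<^sub>v v = 0\<^sub>v ?n"
    obtain w where w: "\<And>i. i < ?n \<Longrightarrow> w (xs ! i) = v $ i"
      using ex_fun_nth[OF assms] by metis
    obtain i where "i < ?n" "v $ i \<noteq> 0"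
      using v(1,2) by (metis carrier_vecD eq_vecI index_zero_vec)
    then have "\<exists>p\<in>set xs. w p \<noteq> 0" using w by (metis nth_mem)
    moreover have "(\<Sum>q\<in>set xs. h (xs ! i) q * w q) = 0" if "i < ?n" for i
      using mult[OF v(1) that w] v(3) that by simp
    ultimately show "\<exists>v. (\<exists>p\<in>set xs. v p \<noteq> 0) \<and> (\<forall>p\<in>set xs. (\<Sum>q\<in>set xs. h p q * v q) = 0)"
      by (metis in_set_conv_nth)
  next
    fix w assume w: "\<exists>p\<in>set xs. w p \<noteq> 0" "\<forall>p\<in>set xs. (\<Sum>q\<in>set xs. h p q * w q) = 0"
    define v where "v = vec ?n (\<lambda>i. w (xs ! i))"
    have v: "v \<in> carrier_vec ?n" "\<And>i. i < ?n \<Longrightarrow> w (xs ! i) = v $ i" by (auto simp: v_def)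
    have "v \<noteq> 0\<^sub>v ?n"
      using w(1) v(2) by (metis in_set_conv_nth index_zero_vec(1))
    moreover have "?A *\<^sub>v v = 0\<^sub>v ?n"
      using mult[OF v(1) _ v(2)] w(2) by (intro eq_vecI) (auto simp: mat_on_def)
    ultimately show "\<exists>v. v \<in> carrier_vec ?n \<and> v \<noteq> 0\<^sub>v ?n \<and> ?A *\<^sub>v v = 0\<^sub>v ?n"
      using v(1) by blast
  qed
qed

text \<open>Factor the matrix as \<open>[A - B W, B; 0, M]\<close> times
  \<open>[1, 0; W, 1]\<close>. Here \<open>W\<close> stands in for the inverse of \<open>M\<close>
  times \<open>C\<close>.\<close>

lemma det_four_block_Schur:
  fixes A :: "'a::idom mat"
  assumes A: "A \<in> carrier_mat k k" and B: "B \<in> carrier_mat k m"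
    and W: "W \<in> carrier_mat m k" and M: "M \<in> carrier_mat m m" and C: "M * W = C"
  shows "det (four_block_mat A B C M) = det (A - B * W) * det M"
proof -
  have 1: "A - B * W + B * W = A"
    using A B W by (intro eq_matI) auto
  have "C \<in> carrier_mat m k" using M W C by auto
  then have C0: "0\<^sub>m m k + C = C" by simp
  have 2: "four_block_mat A B C M =
      four_block_mat (A - B * W) B (0\<^sub>m m k) M * four_block_mat (1\<^sub>m k) (0\<^sub>m k m) W (1\<^sub>m m)"
    using A B W M
    by (subst mult_four_block_mat[where ?nr1.0 = k and ?n1.0 = k and ?n2.0 = m and ?nr2.0 = m and ?nc1.0 = k and ?nc2.0 = m])
      (auto simp: 1 C C0 minus_carrier_mat)
  have "det (four_block_mat A B C M) =
      det (four_block_mat (A - B * W) B (0\<^sub>m m k) M) * det (four_block_mat (1\<^sub>m k) (0\<^sub>m k m) W (1\<^sub>m m))"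
    unfolding 2 using A B W M by (intro det_mult[where n = "k + m"]) (auto intro!: four_block_carrier_mat minus_carrier_mat)
  also have "det (four_block_mat (A - B * W) B (0\<^sub>m m k) M) = det (A - B * W) * det M"
    using A B W M by (intro det_four_block_mat_lower_left_zero[where n = k and m = m]) (auto intro!: minus_carrier_mat)
  also have "det (four_block_mat (1\<^sub>m k) (0\<^sub>m k m) W (1\<^sub>m m)) = 1"
    using W by (subst det_four_block_mat_upper_right_zero[where n = k and m = m]) auto
  finally show ?thesis by simp
qed

text \<open>The Schur complement formula in labels: \<open>w y\<close> is the column of
  \<open>W\<close> belonging to \<open>y\<close>. It is applied with one or two labels in
  \<open>ys\<close>.\<close>

lemma det_mat_on_append:
  fixes h :: "'a \<Rightarrow> 'a \<Rightarrow> 'b::idom"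
  assumes "distinct xs"
    and w: "\<And>y p. y \<in> set ys \<Longrightarrow> p \<in> set xs \<Longrightarrow> (\<Sum>q\<in>set xs. h p q * w y q) = h p y"
  shows "det (mat_on h (ys @ xs)) =
    det (mat_on (\<lambda>x y. h x y - (\<Sum>q\<in>set xs. h x q * w y q)) ys) * det (mat_on h xs)"
proof -
  let ?k = "length ys" and ?m = "length xs"
  define B where "B = mat ?k ?m (\<lambda>(i, j). h (ys ! i) (xs ! j))"
  define C where "C = mat ?m ?k (\<lambda>(i, j). h (xs ! i) (ys ! j))"
  define W where "W = mat ?m ?k (\<lambda>(i, j). w (ys ! j) (xs ! i))"
  have "mat_on h xs * W = C"
    by (intro eq_matI)
      (auto simp: mat_on_def W_def C_def scalar_prod_def w
        sum_nth_distinct[OF assms(1), of "\<lambda>q. h _ q * w _ q"])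
  moreover have "mat_on h (ys @ xs) = four_block_mat (mat_on h ys) B C (mat_on h xs)"
    by (intro eq_matI) (auto simp: mat_on_def B_def C_def nth_append)
  moreover have "mat_on h ys - B * W = mat_on (\<lambda>x y. h x y - (\<Sum>q\<in>set xs. h x q * w y q)) ys"
    by (intro eq_matI)
      (auto simp: mat_on_def W_def B_def scalar_prod_def
        sum_nth_distinct[OF assms(1), of "\<lambda>q. h _ q * w _ q"])
  ultimately show ?thesis
    using det_four_block_Schur[of "mat_on h ys" ?k B ?m W "mat_on h xs" C]
    by (simp add: B_def W_def)
qed

lemma det_mat_on_Nil [simp]: "det (mat_on h []) = 1"
  by (simp add: mat_on_def det_def)

lemma det_mat_on_1: "det (mat_on h [r]) = (h r r :: 'b::comm_ring_1)"
  by (subst det_single) (auto simp: mat_on_def)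

lemma det_mat_on_2:
  "det (mat_on h [r, s]) = (h r r * h s s - h r s * h s r :: 'b::idom)"
proof -
  let ?c = "\<lambda>a. mat 1 1 (\<lambda>_. a)"
  have "mat_on h [r, s] = four_block_mat (?c (h r r)) (?c (h r s)) (?c (h s r)) (?c (h s s))"
    by (intro eq_matI) (auto simp: mat_on_def nth_Cons')
  then have "det (mat_on h [r, s]) = det (?c (h r r) * ?c (h s s) - ?c (h r s) * ?c (h s r))"
    by (subst det_four_block_mat[of _ 1, symmetric]) (auto intro!: eq_matI simp: scalar_prod_def mult.commute)
  also have "\<dots> = h r r * h s s - h r s * h s r"
    by (subst det_single) (auto simp: scalar_prod_def)
  finally show ?thesis .
qed

section \<open>Positive semidefinite forms\<close>

text \<open>The inner sum is the entry of \<open>h v\<close> at \<open>p\<close>, so a linear system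
  solved by \<open>v\<close> can be substituted directly.\<close>

definition blf :: "('a \<Rightarrow> 'a \<Rightarrow> real) \<Rightarrow> 'a set \<Rightarrow> ('a \<Rightarrow> real) \<Rightarrow> ('a \<Rightarrow> real) \<Rightarrow> real" where
  "blf h S u v = (\<Sum>p\<in>S. u p * (\<Sum>q\<in>S. h p q * v q))"

definition psd_on :: "('a \<Rightarrow> 'a \<Rightarrow> real) \<Rightarrow> 'a set \<Rightarrow> bool" where
  "psd_on h S \<longleftrightarrow> (\<forall>p\<in>S. \<forall>q\<in>S. h p q = h q p) \<and> (\<forall>v. 0 \<le> blf h S v v)"

lemma psd_on_nonneg: "psd_on h S \<Longrightarrow> 0 \<le> blf h S v v"
  by (simp add: psd_on_def)

lemma psd_on_sym: "psd_on h S \<Longrightarrow> p \<in> S \<Longrightarrow> q \<in> S \<Longrightarrow> h p q = h q p"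
  by (simp add: psd_on_def)

lemma blf_add_left: "blf h S (\<lambda>p. u p + a * u' p) v = blf h S u v + a * blf h S u' v"
  by (simp add: blf_def algebra_simps sum.distrib sum_distrib_left)

lemma blf_add_right: "blf h S u (\<lambda>p. v p + a * v' p) = blf h S u v + a * blf h S u v'"
  by (simp add: blf_def algebra_simps sum.distrib sum_distrib_left)

lemma blf_commute:
  assumes "psd_on h S"
  shows "blf h S u v = blf h S v u"
proof -
  have "blf h S u v = (\<Sum>q\<in>S. \<Sum>p\<in>S. u p * h p q * v q)"
    unfolding blf_def sum_distrib_left by (subst sum.swap) (simp add: mult.assoc)
  also have "\<dots> = blf h S v u"
    unfolding blf_def sum_distrib_left
    by (intro sum.cong refl) (simp add: psd_on_sym[OF assms] mult_ac)
  finally show ?thesis .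
qed

lemma blf_cong:
  "(\<And>p q. p \<in> S \<Longrightarrow> q \<in> S \<Longrightarrow> h p q = h' p q) \<Longrightarrow> (\<And>p. p \<in> S \<Longrightarrow> u p = u' p) \<Longrightarrow>
   (\<And>p. p \<in> S \<Longrightarrow> v p = v' p) \<Longrightarrow> blf h S u v = blf h' S u' v'"
  by (simp add: blf_def)

lemma blf_quad:
  assumes "psd_on h S"
  shows "blf h S (\<lambda>p. u p + a * v p) (\<lambda>p. u p + a * v p) =
    blf h S u u + 2 * a * blf h S v u + a\<^sup>2 * blf h S v v"
  by (simp add: blf_add_left blf_add_right blf_commute[OF assms, of u v] algebra_simps power2_eq_square)

text \<open>With \<open>k\<close> a column of a symmetric \<open>h\<close>, this turns sums over a
  row into values of \<open>blf\<close>.\<close>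

lemma blf_solution:
  assumes "\<And>p. p \<in> S \<Longrightarrow> (\<Sum>q\<in>S. h p q * w q) = k p"
  shows "blf h S u w = (\<Sum>p\<in>S. u p * k p)"
  using assms by (simp add: blf_def)

lemma blf_insert:
  assumes "finite S" "r \<notin> S" "\<And>q. q \<in> S \<Longrightarrow> h q r = h r q"
  shows "blf h (insert r S) v v =
    (v r)\<^sup>2 * h r r + 2 * v r * (\<Sum>q\<in>S. h r q * v q) + blf h S v v"
  using assms
  by (simp add: blf_def algebra_simps sum.distrib sum_distrib_left power2_eq_square)

lemma psd_on_subset:
  assumes "psd_on h S" "T \<subseteq> S" "finite S"
  shows "psd_on h T"
proof -
  have "blf h T v v = blf h S (\<lambda>p. if p \<in> T then v p else 0) (\<lambda>p. if p \<in> T then v p else 0)" for v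
  proof -
    have 1: "(\<Sum>q\<in>T. h p q * v q) = (\<Sum>q\<in>S. h p q * (if q \<in> T then v q else 0))" for p
      using assms by (intro sum.mono_neutral_cong_left) auto
    show ?thesis
      unfolding blf_def 1 using assms by (intro sum.mono_neutral_cong_left) auto
  qed
  then show ?thesis
    using assms unfolding psd_on_def by (metis subsetD)
qed

text \<open>Along the line \<open>k + a * u\<close> with \<open>k = h u\<close> the form is affine
  in \<open>a\<close>, because its quadratic term vanishes. Being nonnegative for all
  \<open>a\<close>, it has slope zero, and the slope is twice the squared length of
  \<open>h u\<close>.\<close>

lemma psd_on_kernel:
  assumes psd: "psd_on h S" and u: "blf h S u u = 0" and p: "p \<in> S" and fin: "finite S"
  shows "(\<Sum>q\<in>S. h p q * u q) = 0"
proof -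
  define k where "k p = (\<Sum>q\<in>S. h p q * u q)" for p
  define B where "B = blf h S k u"
  have ineq: "0 \<le> blf h S k k + 2 * a * B" for a
    using psd_on_nonneg[OF psd, of "\<lambda>p. k p + a * u p"]
    by (simp add: blf_quad[OF psd] u blf_commute[OF psd, of u k] B_def)
  have "B = 0"
  proof (rule ccontr)
    assume "B \<noteq> 0"
    \<comment> \<open>This value of \<open>a\<close> makes the right-hand side equal to
      \<open>-1\<close>.\<close>
    then show False
      using ineq[of "- (blf h S k k + 1) / (2 * B)"] by (simp add: field_simps)
  qed
  moreover have "B = (\<Sum>p\<in>S. (k p)\<^sup>2)"
    by (simp add: B_def blf_def k_def power2_eq_square)
  ultimately have "k p = 0"
    using p fin by (simp add: sum_nonneg_eq_0_iff)
  then show ?thesis by (simp add: k_def)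
qed

text \<open>A kernel vector of the smaller block, extended by zero at \<open>r\<close>, makes the
  form vanish, hence lies in the kernel of the larger block by \<open>psd_on_kernel\<close>.\<close>

lemma det_mat_on_psd_Cons_eq_0:
  assumes psd: "psd_on h (set (r # xs))" and dist: "distinct (r # xs)"
    and 0: "det (mat_on h xs) = 0"
  shows "det (mat_on h (r # xs)) = 0"
proof -
  obtain v where v: "\<exists>p\<in>set xs. v p \<noteq> 0" "\<And>p. p \<in> set xs \<Longrightarrow> (\<Sum>q\<in>set xs. h p q * v q) = 0"
    using 0 dist by (auto simp: det_mat_on_eq_0_iff)
  define u where "u = v(r := 0)"
  have u: "u r = 0" "\<And>p. p \<in> set xs \<Longrightarrow> u p = v p"
    using dist by (auto simp: u_def)
  have "blf h (set xs) v v = 0"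
    by (simp add: blf_def v(2))
  moreover have "blf h (set xs) u u = blf h (set xs) v v"
    by (intro blf_cong) (auto simp: u)
  ultimately have "blf h (set (r # xs)) u u = 0"
    using dist psd_on_sym[OF psd] by (simp add: blf_insert u(1))
  then have "(\<Sum>q\<in>set (r # xs). h p q * u q) = 0" if "p \<in> set (r # xs)" for p
    using psd_on_kernel[OF psd _ that] by simp
  moreover have "\<exists>p\<in>set (r # xs). u p \<noteq> 0"
    using v(1) u(2) by force
  ultimately show ?thesis
    using det_mat_on_eq_0_iff[OF dist] by metis
qed

text \<open>At the vector that is \<open>1\<close> at \<open>r\<close> and \<open>- w\<close> on
  \<open>S\<close>, the form takes the value \<open>h r r - blf h S w w\<close>.\<close>

lemma psd_Schur_nonneg:
  assumes psd: "psd_on h (insert r S)" and "finite S" "r \<notin> S"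
    and w: "\<And>p. p \<in> S \<Longrightarrow> (\<Sum>q\<in>S. h p q * w q) = h p r"
  shows "blf h S w w \<le> h r r"
proof -
  define u where "u = (\<lambda>p. - w p)(r := 1)"
  have u: "u r = 1" "\<And>p. p \<in> S \<Longrightarrow> u p = - w p"
    using assms(3) by (auto simp: u_def)
  have "blf h S u u = blf h S w w"
    by (simp add: blf_def u sum_negf)
  moreover have "(\<Sum>q\<in>S. h r q * u q) = - blf h S w w"
    using psd_on_sym[OF psd] by (simp add: blf_solution[OF w] u sum_negf mult.commute)
  ultimately show ?thesis
    using psd_on_nonneg[OF psd, of u] assms(2,3) psd_on_sym[OF psd]
    by (simp add: blf_insert u)
qed

text \<open>Peel off one label at a time: either the smaller determinant vanishes and the larger one
  with it, or the larger one is the smaller one times a nonnegative Schur complement.\<close>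

lemma det_mat_on_psd_nonneg:
  assumes "psd_on h (set xs)" "distinct xs"
  shows "0 \<le> det (mat_on h xs)"
  using assms
proof (induction xs)
  case (Cons r xs)
  have psd: "psd_on h (set xs)"
    using Cons.prems(1) by (rule psd_on_subset) auto
  show ?case
  proof (cases "det (mat_on h xs) = 0")
    case True
    then show ?thesis using Cons.prems det_mat_on_psd_Cons_eq_0 by fastforce
  next
    case False
    obtain w where w: "\<And>p. p \<in> set xs \<Longrightarrow> (\<Sum>q\<in>set xs. h p q * w q) = h p r"
      using mat_on_solvable[OF _ False, of "\<lambda>p. h p r"] Cons.prems(2) by auto
    have "(\<Sum>q\<in>set xs. h r q * w q) = blf h (set xs) w w"
      using psd_on_sym[OF Cons.prems(1)] by (simp add: blf_solution[OF w] mult.commute)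
    then have "det (mat_on h (r # xs)) = (h r r - blf h (set xs) w w) * det (mat_on h xs)"
      using det_mat_on_append[of xs "[r]" h "\<lambda>_. w"] w Cons.prems(2)
      by (simp add: det_mat_on_1)
    then show ?thesis
      using Cons.IH[OF psd] Cons.prems psd_Schur_nonneg[of h r "set xs" w] w by simp
  qed
qed auto

text \<open>Completing the square splits the form into \<open>(v r)^2 * (b - blf h S w w)\<close>
  and a value of the form on \<open>S\<close>, both nonnegative.\<close>

lemma psd_on_replace_diag:
  assumes psd: "psd_on h (insert r S)" and S: "finite S" "r \<notin> S"
    and w: "\<And>p. p \<in> S \<Longrightarrow> (\<Sum>q\<in>S. h p q * w q) = h p r"
    and b: "blf h S w w \<le> b"
  shows "psd_on (\<lambda>p q. if p = r \<and> q = r then b else h p q) (insert r S)" (is "psd_on ?h _")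
proof -
  have psdS: "psd_on h S"
    using psd by (rule psd_on_subset) (use S in auto)
  have "0 \<le> blf ?h (insert r S) v v" for v
  proof -
    have 1: "blf ?h S v v = blf h S v v"
      using S by (intro blf_cong) auto
    have 2: "(\<Sum>q\<in>S. ?h r q * v q) = blf h S v w"
      using psd_on_sym[OF psd] S by (auto simp: blf_solution[OF w] mult.commute intro!: sum.cong)
    have "blf ?h (insert r S) v v = (v r)\<^sup>2 * b + 2 * v r * blf h S v w + blf h S v v"
      by (subst blf_insert) (use S psd_on_sym[OF psd] 1 2 in auto)
    also have "\<dots> = (v r)\<^sup>2 * (b - blf h S w w) + blf h S (\<lambda>p. v p + v r * w p) (\<lambda>p. v p + v r * w p)"
      by (simp add: blf_quad[OF psdS] blf_commute[OF psdS, of v w] algebra_simps)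
    also have "0 \<le> \<dots>"
      using b psd_on_nonneg[OF psdS] by simp
    finally show ?thesis .
  qed
  then show ?thesis
    using psd_on_sym[OF psd] by (auto simp: psd_on_def)
qed

text \<open>The diagonal entry enters only through the one-label Schur complement, and
  \<open>w\<close> solves the same system after the change, as \<open>r\<close> is not in
  \<open>xs\<close>.\<close>

lemma det_replace_diag:
  assumes psd: "psd_on h (insert r (set xs))" and dist: "distinct (r # xs)"
    and w: "\<And>p. p \<in> set xs \<Longrightarrow> (\<Sum>q\<in>set xs. h p q * w q) = h p r"
  shows "det (mat_on (\<lambda>p q. if p = r \<and> q = r then b else h p q) (r # xs)) =
    (b - blf h (set xs) w w) * det (mat_on h xs)" (is "det (mat_on ?h _) = _")
proof -
  have "mat_on ?h xs = mat_on h xs"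
    using dist by (intro mat_on_cong) auto
  moreover have "(\<Sum>q\<in>set xs. ?h r q * w q) = blf h (set xs) w w"
    using psd_on_sym[OF psd] dist
    by (auto simp: blf_solution[OF w] mult.commute intro!: sum.cong)
  moreover have "(\<Sum>q\<in>set xs. ?h p q * w q) = ?h p r" if "p \<in> set xs" for p
    using w[OF that] dist that by auto
  ultimately show ?thesis
    using det_mat_on_append[of xs "[r]" ?h "\<lambda>_. w"] dist
    by (simp add: det_mat_on_1)
qed

lemma psd_on_of_pos_semidef:
  assumes "pos_semidef t A"
  shows "psd_on (\<lambda>p q. A $$ (p, q)) {..<t}"
  unfolding psd_on_def
proof (intro conjI ballI allI)
  have A: "A \<in> carrier_mat t t" and sym: "transpose_mat A = A"
    using assms by (auto simp: pos_semidef_def)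
  show "A $$ (p, q) = A $$ (q, p)" if "p \<in> {..<t}" "q \<in> {..<t}" for p q
    using that A index_transpose_mat(1)[of p A q] by (simp add: sym)
  fix v :: "nat \<Rightarrow> real"
  have "0 \<le> vec t v \<bullet> (A *\<^sub>v vec t v)"
    using assms by (simp add: pos_semidef_def)
  also have "\<dots> = blf (\<lambda>p q. A $$ (p, q)) {..<t} v v"
    using A by (simp add: blf_def scalar_prod_def atLeast0LessThan)
  finally show "0 \<le> blf (\<lambda>p q. A $$ (p, q)) {..<t} v v" .
qed

section \<open>The counting bound\<close>

text \<open>A monomial \<open>x\<^sup>\<mu>\<close> outside \<open>J_H\<close> is encoded by \<open>u p = \<gamma>\<^sub>p - 1 - \<mu> p\<close>; avoiding the generator of a pair
  \<open>p, q\<close> then reads \<open>h p q \<le> max (u p) (u q)\<close>.\<close>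

definition free_set :: "('a \<Rightarrow> 'a \<Rightarrow> nat) \<Rightarrow> 'a set \<Rightarrow> ('a \<Rightarrow> nat) set" where
  "free_set h S = {u \<in> (\<Pi>\<^sub>E p\<in>S. {..<h p p}). \<forall>p\<in>S. \<forall>q\<in>S. p \<noteq> q \<longrightarrow> h p q \<le> max (u p) (u q)}"

lemma finite_free_set: "finite S \<Longrightarrow> finite (free_set h S)"
  by (simp add: free_set_def finite_PiE)

lemma free_set_less: "u \<in> free_set h S \<Longrightarrow> p \<in> S \<Longrightarrow> u p < h p p"
  by (auto simp: free_set_def)

lemma free_set_mono:
  assumes "\<And>p. p \<in> S \<Longrightarrow> h p p \<le> h' p p"
    and "\<And>p q. p \<in> S \<Longrightarrow> q \<in> S \<Longrightarrow> p \<noteq> q \<Longrightarrow> h' p q \<le> h p q"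
  shows "free_set h S \<subseteq> free_set h' S"
proof
  fix u assume u: "u \<in> free_set h S"
  have "u \<in> (\<Pi>\<^sub>E p\<in>S. {..<h' p p})"
    using u assms(1) by (force simp: free_set_def PiE_def Pi_def)
  moreover have "h' p q \<le> max (u p) (u q)" if "p \<in> S" "q \<in> S" "p \<noteq> q" for p q
    using u assms(2)[OF that] that by (fastforce simp: free_set_def)
  ultimately show "u \<in> free_set h' S"
    by (simp add: free_set_def)
qed

text \<open>All new constraints involve \<open>r\<close>, and the value \<open>a\<close> alone meets
  each of them.\<close>

lemma free_set_insert:
  assumes v: "v \<in> free_set h S" and r: "r \<notin> S" and a: "a < h r r"
    and le: "\<And>q. q \<in> S \<Longrightarrow> h r q \<le> a \<and> h q r \<le> a"
  shows "v(r := a) \<in> free_set h (insert r S)"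
  using assms by (auto simp: free_set_def PiE_def extensional_def le_max_iff_disj)

text \<open>Members of \<open>F\<close> share the default value at \<open>r\<close>, so overwriting
  it loses nothing: both \<open>a\<close> and \<open>v\<close> can be recovered.\<close>

lemma inj_on_fun_upd_extensional:
  assumes "r \<notin> S" and "F \<subseteq> extensional S"
  shows "inj_on (\<lambda>(a, v). v(r := a)) (A \<times> F)"
proof (rule inj_onI, clarify)
  fix a a' v v'
  assume *: "v \<in> F" "v' \<in> F" "v(r := a) = v'(r := a')"
  have "v r = v' r"
    using assms * by (metis extensional_arb subsetD)
  then have "v p = v' p" for p
    using fun_cong[OF *(3), of p] by (cases "p = r") auto
  then show "a = a' \<and> v = v'"
    using fun_cong[OF *(3), of r] by auto
qed

text \<open>A coordinate \<open>u r \<ge> b\<close> meets all constraints involving \<open>r\<close>. The three terms count the points with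
  both of \<open>u r\<close>, \<open>u s\<close> at least \<open>b\<close>, only \<open>u s\<close>, and only \<open>u r\<close>.\<close>

lemma card_free_set_ge:
  fixes h :: "'a \<Rightarrow> 'a \<Rightarrow> nat"
  assumes S: "finite S" "r \<notin> S" "s \<notin> S" "r \<noteq> s"
    and b: "h r s = b" "h s r = b" "b \<le> h r r" "b \<le> h s s"
    and max: "\<And>q. q \<in> S \<Longrightarrow> h r q \<le> b \<and> h q r \<le> b \<and> h s q \<le> b \<and> h q s \<le> b"
  shows "(h r r - b) * (h s s - b) * card (free_set h S)
    + (h s s - b) * card (free_set (\<lambda>p q. if p = r \<and> q = r then b else h p q) (insert r S))
    + (h r r - b) * card (free_set (\<lambda>p q. if p = s \<and> q = s then b else h p q) (insert s S))
    \<le> card (free_set h (insert r (insert s S)))"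
proof -
  let ?hr = "\<lambda>p q. if p = r \<and> q = r then b else h p q"
  let ?hs = "\<lambda>p q. if p = s \<and> q = s then b else h p q"
  let ?up = "\<lambda>x. \<lambda>(a, v). v(x := a)"
  \<comment> \<open>Labels are added one at a time: \<open>X\<close> extends points on
    \<open>S\<close> by a large value at \<open>s\<close> and then at \<open>r\<close>, while
    \<open>Y\<close> and \<open>Z\<close> extend points whose other coordinate is kept below
    \<open>b\<close> by the lowered diagonal.\<close>
  define X1 where "X1 = ?up s ` ({b..<h s s} \<times> free_set h S)"
  define X where "X = ?up r ` ({b..<h r r} \<times> X1)"
  define Y where "Y = ?up s ` ({b..<h s s} \<times> free_set ?hr (insert r S))"
  define Z where "Z = ?up r ` ({b..<h r r} \<times> free_set ?hs (insert s S))"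
  let ?F = "free_set h (insert r (insert s S))"
  have ext: "free_set f T \<subseteq> extensional T" for f :: "'a \<Rightarrow> 'a \<Rightarrow> nat" and T
    by (auto simp: free_set_def PiE_def)
  have X1: "X1 \<subseteq> free_set h (insert s S)"
    unfolding X1_def using S max by (auto intro!: free_set_insert) (meson order_trans)+
  have cX1: "card X1 = (h s s - b) * card (free_set h S)"
    unfolding X1_def using S inj_on_fun_upd_extensional[OF S(3) ext]
    by (subst card_image) (simp_all add: card_cartesian_product)
  have X: "X \<subseteq> ?F"
    unfolding X_def using X1 S max b by (auto intro!: free_set_insert) (meson order_trans)+
  have cX: "card X = (h r r - b) * ((h s s - b) * card (free_set h S))"
    unfolding X_def cX1[symmetric]
    using S inj_on_fun_upd_extensional[of r "insert s S" X1] X1 ext[of h "insert s S"]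
    by (subst card_image) (auto simp: card_cartesian_product)
  have sub_r: "free_set ?hr (insert r S) \<subseteq> free_set h (insert r S)"
    and sub_s: "free_set ?hs (insert s S) \<subseteq> free_set h (insert s S)"
    by (rule free_set_mono; use S b in auto)+
  have Y: "Y \<subseteq> free_set h (insert s (insert r S))"
    unfolding Y_def using S max b by (auto intro!: free_set_insert subsetD[OF sub_r]) (meson order_trans)+
  then have Y: "Y \<subseteq> ?F" by (simp add: insert_commute)
  have cY: "card Y = (h s s - b) * card (free_set ?hr (insert r S))"
    unfolding Y_def using S inj_on_fun_upd_extensional[of s "insert r S" "free_set ?hr (insert r S)"] ext
    by (subst card_image) (auto simp: card_cartesian_product)
  have Z: "Z \<subseteq> ?F"
    unfolding Z_def using S max b by (auto intro!: free_set_insert subsetD[OF sub_s]) (meson order_trans)+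
  have cZ: "card Z = (h r r - b) * card (free_set ?hs (insert s S))"
    unfolding Z_def using S inj_on_fun_upd_extensional[of r "insert s S" "free_set ?hs (insert s S)"] ext
    by (subst card_image) (auto simp: card_cartesian_product)
  have fin: "finite ?F" by (rule finite_free_set) (use S in auto)
  have fins: "finite X" "finite Y" "finite Z"
    by (rule finite_subset[OF X fin] finite_subset[OF Y fin] finite_subset[OF Z fin])+
  have mX: "b \<le> u r \<and> b \<le> u s" if "u \<in> X" for u
    using that S by (auto simp: X_def X1_def)
  have mY: "u r < b \<and> b \<le> u s" if "u \<in> Y" for u
    using that S free_set_less[of _ ?hr "insert r S" r] by (auto simp: Y_def)
  have mZ: "u s < b \<and> b \<le> u r" if "u \<in> Z" for u
    using that S free_set_less[of _ ?hs "insert s S" s] by (auto simp: Z_def)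
  have "X \<inter> Y = {}" "(X \<union> Y) \<inter> Z = {}"
    by (auto dest!: mX mY mZ)
  then have "card X + card Y + card Z = card (X \<union> Y \<union> Z)"
    using fins by (simp add: card_Un_disjoint)
  also have "\<dots> \<le> card ?F"
    using X Y Z fin by (intro card_mono) auto
  finally show ?thesis by (simp add: cX cY cZ mult.assoc)
qed

text \<open>The witness is the top corner of the box, the point encoding the monomial
  \<open>1\<close>.\<close>

lemma free_set_pos:
  assumes "finite S" and "\<And>p. p \<in> S \<Longrightarrow> 0 < h p p"
    and "\<And>p q. p \<in> S \<Longrightarrow> q \<in> S \<Longrightarrow> p \<noteq> q \<Longrightarrow> h p q < h p p \<or> h p q < h q q"
  shows "0 < card (free_set h S)"
proof -
  have "h p q \<le> max (h p p - 1) (h q q - 1)" if "p \<in> S" "q \<in> S" "p \<noteq> q" for p q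
    using assms(3)[OF that] by auto
  then have "(\<lambda>p\<in>S. h p p - 1) \<in> free_set h S"
    using assms(2) by (auto simp: free_set_def)
  then show ?thesis
    using finite_free_set[OF assms(1)] by (auto simp: card_gt_0_iff)
qed

section \<open>The two-by-two minor and the induction\<close>

text \<open>With \<open>W\<close> the Schur correction, \<open>det (b - W) = - V (b - Wr) - (Wr - Wx)\<^sup>2\<close> where
  \<open>V = Wr + Ws - 2 Wx\<close>, so this minor is nonpositive once \<open>b - Wr\<close> and \<open>b - Ws\<close> are nonnegative.\<close>

lemma two_by_two_ineq:
  fixes c \<delta>r \<delta>s b Wr Ws Wx N NC Nr Ns D :: real
  assumes c: "0 < c" "c \<le> NC" and \<delta>: "0 \<le> \<delta>r" "0 \<le> \<delta>s"
    and psd: "0 \<le> \<delta>r + (b - Wr)" "0 \<le> \<delta>s + (b - Ws)"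
    and V: "0 \<le> Wr + Ws - 2 * Wx"
    and Nr: "0 \<le> Nr" "Wr \<le> b \<Longrightarrow> (b - Wr) * c \<le> Nr"
    and Ns: "0 \<le> Ns" "Ws \<le> b \<Longrightarrow> (b - Ws) * c \<le> Ns"
    and N: "\<delta>r * \<delta>s * NC + \<delta>s * Nr + \<delta>r * Ns \<le> N"
    and D: "D = ((\<delta>r + (b - Wr)) * (\<delta>s + (b - Ws)) - (b - Wx)\<^sup>2) * c"
  shows "D \<le> N" and "0 < Wr + Ws - 2 * Wx \<Longrightarrow> 0 < N \<Longrightarrow> D < N"
proof -
  \<comment> \<open>\<open>x\<close>, \<open>y\<close>, \<open>z\<close> are the entries of the
    minor without the surpluses \<open>\<delta>r\<close>, \<open>\<delta>s\<close>; in the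
    application \<open>V\<close> is the form at the difference of two solutions.\<close>
  define x y z V where "x = b - Wr" "y = b - Ws" "z = b - Wx" "V = Wr + Ws - 2 * Wx"
  note defs = this
  have D: "D = ((\<delta>r + x) * (\<delta>s + y) - z\<^sup>2) * c"
    by (simp add: D defs)
  have det: "x * y - z\<^sup>2 = - V * x - (Wr - Wx)\<^sup>2" "x * y - z\<^sup>2 = - V * y - (Ws - Wx)\<^sup>2"
    by (simp_all add: defs power2_eq_square algebra_simps)
  have NC: "\<delta>r * \<delta>s * c \<le> \<delta>r * \<delta>s * NC"
    using c \<delta> by (intro mult_left_mono) auto
  have zero: "0 \<le> \<delta>s * Nr" "0 \<le> \<delta>r * Ns"
    using \<delta> Nr Ns by auto
  have D_le: "D \<le> (\<delta>r + x) * (\<delta>s + y) * c"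
    using c by (simp add: D)
  have Nr': "\<delta>s * (x * c) \<le> \<delta>s * Nr" if "0 \<le> x"
    using Nr(2) that \<delta> by (intro mult_left_mono) (auto simp: defs)
  have Ns': "\<delta>r * (y * c) \<le> \<delta>r * Ns" if "0 \<le> y"
    using Ns(2) that \<delta> by (intro mult_left_mono) (auto simp: defs)
  have psd': "0 \<le> \<delta>r + x" "0 \<le> \<delta>s + y" using psd by (simp_all add: defs)
  have V0: "0 \<le> V" using V by (simp add: defs)
  \<comment> \<open>The signs of \<open>x\<close> and \<open>y\<close> decide which of the bounds on
    \<open>Nr\<close> and \<open>Ns\<close> are available.\<close>
  consider "0 \<le> x" "0 \<le> y" | "x < 0" "0 \<le> y" | "0 \<le> x" "y < 0" | "x < 0" "y < 0"
    by linarith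
  then have "D \<le> N \<and> (0 < V \<longrightarrow> 0 < N \<longrightarrow> D < N)"
  proof cases
    case 1
    have "D = \<delta>r * \<delta>s * c + \<delta>s * (x * c) + \<delta>r * (y * c) + (x * y - z\<^sup>2) * c"
      by (simp add: D algebra_simps)
    then have le: "D \<le> N + (x * y - z\<^sup>2) * c"
      using N NC Nr' Ns' 1 by linarith
    have nonpos: "x * y - z\<^sup>2 \<le> 0"
      unfolding det(1) using mult_nonneg_nonneg[OF V0 1(1)] zero_le_power2[of "Wr - Wx"]
      by linarith
    then have "D \<le> N" using le c by (smt (verit) mult_nonneg_nonpos2)
    moreover have "x * y - z\<^sup>2 < 0" if "0 < V"
    proof (rule ccontr)
      assume "\<not> ?thesis"
      then have 0: "x * y - z\<^sup>2 = 0" using nonpos by simp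
      \<comment> \<open>A vanishing minor forces \<open>Wr = Wx = Ws\<close> through the two
        identities, hence \<open>V = 0\<close>.\<close>
      have "0 \<le> V * x" "0 \<le> V * y" using V0 1 by auto
      with 0 have "V * x = 0" "(Wr - Wx)\<^sup>2 = 0" "V * y = 0" "(Ws - Wx)\<^sup>2 = 0"
        using det zero_le_power2[of "Wr - Wx"] zero_le_power2[of "Ws - Wx"] by linarith+
      then show False using that by (simp add: defs)
    qed
    then have "D < N" if "0 < V"
      using le that c by (smt (verit) mult_neg_pos)
    ultimately show ?thesis by blast
  next
    case 2
    have "(\<delta>r + x) * ((\<delta>s + y) * c) \<le> \<delta>r * ((\<delta>s + y) * c)"
      using 2 psd' c by (intro mult_right_mono) auto
    moreover have "\<delta>r * ((\<delta>s + y) * c) = \<delta>r * \<delta>s * c + \<delta>r * (y * c)"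
      by (simp add: algebra_simps)
    ultimately have "(\<delta>r + x) * ((\<delta>s + y) * c) \<le> N"
      using N NC Ns' 2 zero by linarith
    \<comment> \<open>If \<open>\<delta>s + y = 0\<close>, then \<open>D \<le> 0 < N\<close>;
      otherwise the comparison is strict.\<close>
    moreover have "(\<delta>r + x) * ((\<delta>s + y) * c) < \<delta>r * ((\<delta>s + y) * c)" if "\<delta>s + y \<noteq> 0"
      using 2 psd' c that by (intro mult_strict_right_mono mult_pos_pos) auto
    then have "D < N" if "0 < N"
      using that \<open>\<delta>r * ((\<delta>s + y) * c) = _\<close> D_le N NC Ns' 2 zero
      by (cases "\<delta>s + y = 0") (auto simp: mult.assoc)
    ultimately show ?thesis using D_le by (auto simp: mult.assoc)
  next
    case 3
    have "(\<delta>s + y) * ((\<delta>r + x) * c) \<le> \<delta>s * ((\<delta>r + x) * c)"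
      using 3 psd' c by (intro mult_right_mono) auto
    moreover have "\<delta>s * ((\<delta>r + x) * c) = \<delta>r * \<delta>s * c + \<delta>s * (x * c)"
      by (simp add: algebra_simps)
    ultimately have "(\<delta>s + y) * ((\<delta>r + x) * c) \<le> N"
      using N NC Nr' 3 zero by linarith
    moreover have "(\<delta>s + y) * ((\<delta>r + x) * c) < \<delta>s * ((\<delta>r + x) * c)" if "\<delta>r + x \<noteq> 0"
      using 3 psd' c that by (intro mult_strict_right_mono mult_pos_pos) auto
    then have "D < N" if "0 < N"
      using that \<open>\<delta>s * ((\<delta>r + x) * c) = _\<close> D_le N NC Nr' 3 zero
      by (cases "\<delta>r + x = 0") (auto simp: mult_ac)
    ultimately show ?thesis using D_le by (auto simp: mult_ac)
  next
    case 4
    \<comment> \<open>Nonnegativity of \<open>\<delta>r + x\<close> and \<open>\<delta>s + y\<close>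
      forces both surpluses to be positive; the first term of the count then suffices.\<close>
    then have pos: "0 < \<delta>r" "0 < \<delta>s" using psd' by auto
    have "(\<delta>r + x) * (\<delta>s + y) < \<delta>r * \<delta>s"
      using 4 psd' pos by (intro mult_strict_mono') auto
    then have "(\<delta>r + x) * (\<delta>s + y) * c < \<delta>r * \<delta>s * c"
      using c by simp
    then show ?thesis using D_le N NC zero by linarith
  qed
  then show "D \<le> N" and "0 < Wr + Ws - 2 * Wx \<Longrightarrow> 0 < N \<Longrightarrow> D < N"
    by (auto simp: defs)
qed

text \<open>The induction hypothesis is an assumption, so that one step yields the inequality inside
  the induction and afterwards the strict inequality for a chosen pair. It ranges over all
  \<open>h'\<close> because the diagonal is lowered before it is applied.\<close>

lemma det_le_card_step:
  fixes h :: "'a \<Rightarrow> 'a \<Rightarrow> nat"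
  assumes dist: "distinct (r # s # xs)"
    and psd: "psd_on (\<lambda>p q. real (h p q)) (set (r # s # xs))"
    and dom: "\<And>p q. p \<in> set (r # s # xs) \<Longrightarrow> q \<in> set (r # s # xs) \<Longrightarrow> h p q \<le> h p p"
    and max: "\<And>q. q \<in> set xs \<Longrightarrow> h r q \<le> h r s \<and> h s q \<le> h r s"
    and IH: "\<And>(h' :: 'a \<Rightarrow> 'a \<Rightarrow> nat) ys. length ys < length (r # s # xs) \<Longrightarrow> distinct ys \<Longrightarrow>
      psd_on (\<lambda>p q. real (h' p q)) (set ys) \<Longrightarrow>
      (\<And>p q. p \<in> set ys \<Longrightarrow> q \<in> set ys \<Longrightarrow> h' p q \<le> h' p p) \<Longrightarrow>
      det (mat_on (\<lambda>p q. real (h' p q)) ys) \<le> card (free_set h' (set ys))"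
  defines "D \<equiv> det (mat_on (\<lambda>p q. real (h p q)) (r # s # xs))"
    and "N \<equiv> card (free_set h (set (r # s # xs)))"
  shows "D \<le> N" and "\<exists>q\<in>set xs. h r q \<noteq> h s q \<Longrightarrow> 0 < N \<Longrightarrow> D < N"
proof -
  let ?S = "set xs" and ?g = "\<lambda>p q. real (h p q)"
  define b where "b = h r s"
  let ?hr = "\<lambda>p q. if p = r \<and> q = r then b else h p q"
  let ?hs = "\<lambda>p q. if p = s \<and> q = s then b else h p q"
  have sym: "h p q = h q p" if "p \<in> set (r # s # xs)" "q \<in> set (r # s # xs)" for p q
    using psd_on_sym[OF psd that] by simp
  have psdr: "psd_on ?g (insert r ?S)" and psds: "psd_on ?g (insert s ?S)" and psdS: "psd_on ?g ?S"
    by (rule psd_on_subset[OF psd]; auto)+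
  define c where "c = det (mat_on ?g xs)"
  have "c \<ge> 0"
    unfolding c_def using det_mat_on_psd_nonneg[OF psdS] dist by simp
  show "D \<le> N" and "\<exists>q\<in>set xs. h r q \<noteq> h s q \<Longrightarrow> 0 < N \<Longrightarrow> D < N"
  proof (atomize (full), cases "c = 0")
    case True
    \<comment> \<open>Singularity of the remaining block passes to \<open>s # xs\<close> and then to
      the whole list, so \<open>D = 0\<close>.\<close>
    then have "det (mat_on ?g (s # xs)) = 0"
      using det_mat_on_psd_Cons_eq_0[of ?g s xs] psds dist by (simp add: c_def)
    then have "D = 0"
      unfolding D_def using det_mat_on_psd_Cons_eq_0[OF psd dist] by simp
    then show "D \<le> N \<and> ((\<exists>q\<in>set xs. h r q \<noteq> h s q) \<longrightarrow> 0 < N \<longrightarrow> D < N)" by simp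
  next
    case False
    with \<open>c \<ge> 0\<close> have c: "0 < c" by simp
    \<comment> \<open>\<open>wr\<close> and \<open>ws\<close> solve the system of the remaining
      block for the columns \<open>r\<close> and \<open>s\<close>; \<open>Wr\<close>,
      \<open>Ws\<close>, \<open>Wx\<close> are then the entries of the Schur correction.\<close>
    obtain wr where wr: "\<And>p. p \<in> ?S \<Longrightarrow> (\<Sum>q\<in>?S. ?g p q * wr q) = ?g p r"
      using mat_on_solvable[of xs ?g "\<lambda>p. ?g p r"] dist False by (auto simp: c_def)
    obtain ws where ws: "\<And>p. p \<in> ?S \<Longrightarrow> (\<Sum>q\<in>?S. ?g p q * ws q) = ?g p s"
      using mat_on_solvable[of xs ?g "\<lambda>p. ?g p s"] dist False by (auto simp: c_def)
    define Wr Ws Wx where "Wr = blf ?g ?S wr wr" "Ws = blf ?g ?S ws ws" "Wx = blf ?g ?S wr ws"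
    note W = this
    have sums: "(\<Sum>q\<in>?S. ?g r q * u q) = blf ?g ?S u wr" "(\<Sum>q\<in>?S. ?g s q * u q) = blf ?g ?S u ws" for u
      by (simp_all add: blf_solution[OF wr] blf_solution[OF ws] sym[of r] sym[of s] mult.commute)
    have bs: "h s r = b" using sym[of r s] by (simp add: b_def)
    define w where "w = (\<lambda>y. if y = r then wr else ws)"
    define \<delta>r \<delta>s where "\<delta>r = real (h r r) - b" "\<delta>s = real (h s s) - b"
    note \<delta> = this
    have D: "D = ((\<delta>r + (b - Wr)) * (\<delta>s + (b - Ws)) - (real b - Wx)\<^sup>2) * c"
    proof -
      have "D = det (mat_on (\<lambda>x y. ?g x y - (\<Sum>q\<in>?S. ?g x q * w y q)) [r, s]) * c"
      proof -
        have "(\<Sum>q\<in>?S. ?g p q * w y q) = ?g p y" if "y \<in> set [r, s]" "p \<in> ?S" for y p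
          using that wr ws dist by (cases "y = r") (simp_all add: w_def)
        then show ?thesis
          unfolding D_def c_def using det_mat_on_append[of xs "[r, s]" ?g w] dist by simp
      qed
      moreover have "w r = wr" "w s = ws" using dist by (auto simp: w_def)
      ultimately show ?thesis
        using dist blf_commute[OF psdS, of ws wr]
        by (simp add: det_mat_on_2 sums b_def[symmetric] bs W \<delta> power2_eq_square)
    qed
    have le: "Wr \<le> h r r" "Ws \<le> h s s"
      unfolding W using psd_Schur_nonneg[OF psdr _ _ wr] psd_Schur_nonneg[OF psds _ _ ws] dist by auto
    have diff: "blf ?g ?S (\<lambda>p. wr p + (- 1) * ws p) (\<lambda>p. wr p + (- 1) * ws p) = Wr + Ws - 2 * Wx"
      unfolding blf_quad[OF psdS] W blf_commute[OF psdS, of ws wr] by simp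
    have V: "0 \<le> Wr + Ws - 2 * Wx"
      unfolding diff[symmetric] by (rule psd_on_nonneg[OF psdS])
    have V': "0 < Wr + Ws - 2 * Wx" if ex: "\<exists>q\<in>?S. h r q \<noteq> h s q"
    proof (rule ccontr)
      \<comment> \<open>If the form vanished at \<open>wr - ws\<close>, this vector would lie in the
        kernel of the block, and the columns \<open>r\<close> and \<open>s\<close> would agree on
        \<open>xs\<close>.\<close>
      assume "\<not> ?thesis"
      then have "blf ?g ?S (\<lambda>p. wr p + (- 1) * ws p) (\<lambda>p. wr p + (- 1) * ws p) = 0"
        using V diff by simp
      then have "(\<Sum>q\<in>?S. ?g p q * (wr q + (- 1) * ws q)) = 0" if "p \<in> ?S" for p
        using psd_on_kernel[OF psdS _ that] by simp
      then have "?g p r - ?g p s = 0" if "p \<in> ?S" for p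
        unfolding wr[OF that, symmetric] ws[OF that, symmetric] using that
        by (simp add: algebra_simps sum_subtractf)
      moreover obtain q where "q \<in> ?S" "h r q \<noteq> h s q" using ex by blast
      ultimately show False using sym[of r q] sym[of s q] by fastforce
    qed
    have dr: "b \<le> h r r" "b \<le> h s s"
      using dom[of r s] dom[of s r] bs by (simp_all add: b_def)
    define NC Nr Ns where "NC = card (free_set h ?S)"
      "Nr = card (free_set ?hr (insert r ?S))" "Ns = card (free_set ?hs (insert s ?S))"
    note NN = this
    have N: "\<delta>r * \<delta>s * NC + \<delta>s * Nr + \<delta>r * Ns \<le> N"
    proof -
      have "(h r r - b) * (h s s - b) * NC + (h s s - b) * Nr + (h r r - b) * Ns \<le> N"
        unfolding NN N_def list.set
      proof (rule card_free_set_ge)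
        show "h r q \<le> b \<and> h q r \<le> b \<and> h s q \<le> b \<and> h q s \<le> b" if "q \<in> ?S" for q
          using max[OF that] sym[of r q] sym[of s q] that by (simp add: b_def)
      qed (use dist dr bs in \<open>simp_all add: b_def\<close>)
      then have "real ((h r r - b) * (h s s - b) * NC + (h s s - b) * Nr + (h r r - b) * Ns) \<le> N"
        by linarith
      \<comment> \<open>Both diagonal entries are at least \<open>b\<close>, so the natural
        subtractions carry over to the reals.\<close>
      then show ?thesis using dr by (simp add: \<delta> of_nat_diff)
    qed
    have NC: "c \<le> NC"
      unfolding c_def NN by (rule IH) (use dist dom psdS in auto)
    have real_if: "(\<lambda>p q. real (if p = x \<and> q = x then b else h p q)) =
      (\<lambda>p q. if p = x \<and> q = x then real b else real (h p q))" for x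
      by (intro ext) auto
    have Nr: "(b - Wr) * c \<le> Nr" if "Wr \<le> b"
    proof -
      have "(b - Wr) * c = det (mat_on (\<lambda>p q. real (?hr p q)) (r # xs))"
        unfolding real_if W c_def by (subst det_replace_diag[OF psdr _ wr]) (use dist in auto)
      \<comment> \<open>With \<open>Wr \<le> b\<close> the lowered block stays positive
        semidefinite, and its diagonal stays maximal because \<open>h r s\<close> bounds row
        \<open>r\<close>.\<close>
      also have "\<dots> \<le> card (free_set ?hr (set (r # xs)))"
      proof (rule IH)
        show "psd_on (\<lambda>p q. real (?hr p q)) (set (r # xs))"
          unfolding real_if using psd_on_replace_diag[OF psdr _ _ wr] that dist by (simp add: W)
      qed (use dist dom max in \<open>auto simp: b_def\<close>)
      finally show ?thesis by (simp add: NN)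
    qed
    have Ns: "(b - Ws) * c \<le> Ns" if "Ws \<le> b"
    proof -
      have "(b - Ws) * c = det (mat_on (\<lambda>p q. real (?hs p q)) (s # xs))"
        unfolding real_if W c_def by (subst det_replace_diag[OF psds _ ws]) (use dist in auto)
      also have "\<dots> \<le> card (free_set ?hs (set (s # xs)))"
      proof (rule IH)
        show "psd_on (\<lambda>p q. real (?hs p q)) (set (s # xs))"
          unfolding real_if using psd_on_replace_diag[OF psds _ _ ws] that dist by (simp add: W)
      qed (use dist dom max in \<open>auto simp: b_def\<close>)
      finally show ?thesis by (simp add: NN)
    qed
    have \<delta>0: "0 \<le> \<delta>r" "0 \<le> \<delta>s" and \<delta>W: "0 \<le> \<delta>r + (b - Wr)" "0 \<le> \<delta>s + (b - Ws)"
      using dr le by (simp_all add: \<delta>)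
    show "D \<le> N \<and> ((\<exists>q\<in>set xs. h r q \<noteq> h s q) \<longrightarrow> 0 < N \<longrightarrow> D < N)"
      using two_by_two_ineq[OF c NC \<delta>0 \<delta>W V _ Nr _ Ns N D] V' by auto
  qed
qed

text \<open>Strong induction on the number of labels. From two labels on, a pair with the largest
  off-diagonal entry is moved to the front, which leaves the determinant unchanged, and
  \<open>det_le_card_step\<close> applies.\<close>

theorem det_le_card_free_set:
  fixes h :: "'a \<Rightarrow> 'a \<Rightarrow> nat"
  assumes "distinct xs" and "psd_on (\<lambda>p q. real (h p q)) (set xs)"
    and "\<And>p q. p \<in> set xs \<Longrightarrow> q \<in> set xs \<Longrightarrow> h p q \<le> h p p"
  shows "det (mat_on (\<lambda>p q. real (h p q)) xs) \<le> card (free_set h (set xs))"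
  using assms
proof (induction "length xs" arbitrary: xs h rule: less_induct)
  case (less xs h)
  let ?S = "set xs"
  consider "xs = []" | x where "xs = [x]" | x y zs where "xs = x # y # zs"
    by (metis neq_Nil_conv)
  then show ?case
  proof cases
    case 1
    \<comment> \<open>Both sides are \<open>1\<close>: the only point is the function with the
      default value everywhere.\<close>
    then show ?thesis by (simp add: free_set_def)
  next
    case (2 x)
    have "free_set h {x} = (\<Pi>\<^sub>E p\<in>{x}. {..<h p p})"
      by (auto simp: free_set_def)
    then show ?thesis
      using 2 by (simp add: det_mat_on_1 card_PiE)
  next
    case (3 x y zs)
    define M where "M = {(p, q). p \<in> ?S \<and> q \<in> ?S \<and> p \<noteq> q}"
    have "finite M"
      by (rule finite_subset[of _ "?S \<times> ?S"]) (auto simp: M_def)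
    moreover have "(x, y) \<in> M"
      using 3 less.prems(1) by (auto simp: M_def)
    ultimately have "Max (case_prod h ` M) \<in> case_prod h ` M"
      by (intro Max_in) auto
    then obtain r s where rs: "(r, s) \<in> M" and "h r s = Max (case_prod h ` M)"
      by auto
    then have max: "h p q \<le> h r s" if "(p, q) \<in> M" for p q
      using that \<open>finite M\<close> by (auto intro!: Max_ge simp: image_iff)
    obtain ys where "distinct ys" "set ys = ?S - {r, s}"
      using finite_distinct_list[of "?S - {r, s}"] by auto
    then have dist: "distinct (r # s # ys)" and "set (r # s # ys) = ?S"
      using rs by (auto simp: M_def)
    then have ys: "mset xs = mset (r # s # ys)"
      using less.prems(1) set_eq_iff_mset_eq_distinct by metis
    have set: "set (r # s # ys) = ?S" and len: "length (r # s # ys) = length xs"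
      using ys mset_eq_setD mset_eq_length by metis+
    have "det (mat_on (\<lambda>p q. real (h p q)) (r # s # ys)) \<le> card (free_set h (set (r # s # ys)))"
    proof (rule det_le_card_step(1)[OF dist])
      show "h r q \<le> h r s \<and> h s q \<le> h r s" if "q \<in> set ys" for q
        using that dist set max[of r q] max[of s q] by (auto simp: M_def)
      show "psd_on (\<lambda>p q. real (h p q)) (set (r # s # ys))"
        unfolding set by (rule less.prems(2))
      show "h p q \<le> h p p" if "p \<in> set (r # s # ys)" "q \<in> set (r # s # ys)" for p q
        using that unfolding set by (rule less.prems(3))
      show "det (mat_on (\<lambda>p q. real (h' p q)) zs) \<le> card (free_set h' (set zs))"
        if "length zs < length (r # s # ys)" "distinct zs" "psd_on (\<lambda>p q. real (h' p q)) (set zs)"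
          "\<And>p q. p \<in> set zs \<Longrightarrow> q \<in> set zs \<Longrightarrow> h' p q \<le> h' p p" for h' :: "'a \<Rightarrow> 'a \<Rightarrow> nat" and zs
        using that unfolding len by (rule less.hyps)
    qed
    then show ?thesis
      unfolding det_mat_on_mset[OF ys] set .
  qed
qed

section \<open>Monomial quotients\<close>

definition exponents :: "nat \<Rightarrow> (nat \<Rightarrow>\<^sub>0 nat) set" where
  "exponents t = {\<mu>. Poly_Mapping.keys \<mu> \<subseteq> {..<t}}"

lemma exponents_0 [simp]: "0 \<in> exponents t"
  by (simp add: exponents_def)

text \<open>Exponents are natural numbers, so nothing cancels in a sum. In particular a divisor and
  its cofactor stay within the given variables.\<close>

lemma exponents_add [simp]: "\<mu> + \<nu> \<in> exponents t \<longleftrightarrow> \<mu> \<in> exponents t \<and> \<nu> \<in> exponents t"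
  by (auto simp: exponents_def subset_iff in_keys_iff lookup_add)

lemma poly_ring_simps [simp]:
  "monoid.mult (poly_ring t) = (*)" "one (poly_ring t) = 1"
  "zero (poly_ring t) = 0" "add (poly_ring t) = (+)"
  by (simp_all add: poly_ring_def)

lemma carrier_poly_ring: "carrier (poly_ring t) = {f. Poly_Mapping.keys f \<subseteq> exponents t}"
  by (auto simp: poly_ring_def exponents_def)

lemma single_in_poly_ring: "\<mu> \<in> exponents t \<Longrightarrow> Poly_Mapping.single \<mu> a \<in> carrier (poly_ring t)"
  by (simp add: carrier_poly_ring)

lemma Const_in_poly_ring: "Const a \<in> carrier (poly_ring t)"
  by (simp add: Const_def single_in_poly_ring)

lemma poly_ring_closed:
  assumes "f \<in> carrier (poly_ring t)" "g \<in> carrier (poly_ring t)"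
  shows "f + g \<in> carrier (poly_ring t)" "f - g \<in> carrier (poly_ring t)" "f * g \<in> carrier (poly_ring t)"
    "- f \<in> carrier (poly_ring t)"
proof -
  show "f + g \<in> carrier (poly_ring t)" "f - g \<in> carrier (poly_ring t)" "- f \<in> carrier (poly_ring t)"
    using assms keys_add[of f g] keys_diff[of f g] by (auto simp: carrier_poly_ring)
  show "f * g \<in> carrier (poly_ring t)"
    unfolding carrier_poly_ring
  proof safe
    fix \<mu> assume "\<mu> \<in> Poly_Mapping.keys (f * g)"
    then obtain \<nu> \<kappa> where "\<nu> \<in> Poly_Mapping.keys f" "\<kappa> \<in> Poly_Mapping.keys g" "\<mu> = \<nu> + \<kappa>"
      using keys_mult[of f g] by blast
    then show "\<mu> \<in> exponents t"
      using assms by (auto simp: carrier_poly_ring)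
  qed
qed

lemma zero_one_in_poly_ring: "0 \<in> carrier (poly_ring t)" "1 \<in> carrier (poly_ring t)"
  by (simp_all add: carrier_poly_ring)

lemma poly_ring_cring: "cring (poly_ring t :: 'k::field mpoly ring)"
proof (rule cringI)
  show "abelian_group (poly_ring t :: 'k mpoly ring)"
  proof (rule abelian_groupI; simp)
    fix f :: "'k mpoly" assume "f \<in> carrier (poly_ring t)"
    then show "\<exists>g\<in>carrier (poly_ring t). g + f = 0"
      by (intro bexI[of _ "- f"]) (auto simp: poly_ring_closed)
  qed (simp_all add: poly_ring_closed zero_one_in_poly_ring add_ac)
  show "comm_monoid (poly_ring t :: 'k mpoly ring)"
    by (rule comm_monoidI) (simp_all add: poly_ring_closed zero_one_in_poly_ring mult_ac)
qed (simp add: algebra_simps)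

lemma a_minus_poly_ring:
  assumes "f \<in> carrier (poly_ring t)" "g \<in> carrier (poly_ring t)"
  shows "f \<ominus>\<^bsub>poly_ring t\<^esub> g = f - (g :: 'k::field mpoly)"
proof -
  interpret cring "poly_ring t :: 'k mpoly ring" by (rule poly_ring_cring)
  have "\<ominus>\<^bsub>poly_ring t\<^esub> g = - g"
    using assms by (intro minus_equality) (auto simp: poly_ring_closed)
  then show ?thesis by (simp add: a_minus_def)
qed

lemma finsum_poly_ring:
  assumes "finite A" "g \<in> A \<rightarrow> carrier (poly_ring t)"
  shows "finsum (poly_ring t) g A = (\<Sum>x\<in>A. g x :: 'k::field mpoly)"
proof -
  interpret cring "poly_ring t :: 'k mpoly ring" by (rule poly_ring_cring)
  show ?thesis using assms by (induction A) auto
qed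

section \<open>Monomial ideals\<close>

text \<open>Membership is tested monomial by monomial. The cofactor \<open>\<nu>\<close>
  automatically involves only the first \<open>t\<close> variables, by
  \<open>exponents_add\<close>.\<close>

definition monomial_ideal :: "nat \<Rightarrow> (nat \<Rightarrow>\<^sub>0 nat) set \<Rightarrow> 'k::field mpoly set" where
  "monomial_ideal t E =
    {f \<in> carrier (poly_ring t). \<forall>\<mu>\<in>Poly_Mapping.keys f. \<exists>e\<in>E. \<exists>\<nu>. \<mu> = e + \<nu>}"

text \<open>Monomials of a sum occur in a summand, and those of a product are products of monomials
  of the factors, so divisibility is inherited.\<close>

lemma ideal_monomial_ideal: "ideal (monomial_ideal t E :: 'k::field mpoly set) (poly_ring t)"
proof (rule idealI)
  show "ring (poly_ring t :: 'k mpoly ring)"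
    using poly_ring_cring cring.axioms(1) by blast
  interpret cring "poly_ring t :: 'k mpoly ring" by (rule poly_ring_cring)
  show "subgroup (monomial_ideal t E :: 'k mpoly set) (add_monoid (poly_ring t))"
  proof (rule add.subgroupI)
    show "monomial_ideal t E \<subseteq> carrier (poly_ring t :: 'k mpoly ring)"
      by (auto simp: monomial_ideal_def)
    show "(monomial_ideal t E :: 'k mpoly set) \<noteq> {}"
    proof -
      have "(0 :: 'k mpoly) \<in> monomial_ideal t E"
        by (simp add: monomial_ideal_def carrier_poly_ring)
      then show ?thesis by blast
    qed
    fix f g :: "'k mpoly"
    assume f: "f \<in> monomial_ideal t E"
    then have "\<ominus>\<^bsub>poly_ring t\<^esub> f = - f"
      by (intro minus_equality) (auto simp: poly_ring_closed monomial_ideal_def)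
    then show "\<ominus>\<^bsub>poly_ring t\<^esub> f \<in> monomial_ideal t E"
      using f by (auto simp: monomial_ideal_def poly_ring_closed)
    assume g: "g \<in> monomial_ideal t E"
    show "f \<oplus>\<^bsub>poly_ring t\<^esub> g \<in> monomial_ideal t E"
    proof -
      have "f + g \<in> carrier (poly_ring t)"
        using f g by (auto simp: monomial_ideal_def intro: poly_ring_closed)
      then show ?thesis
        using f g keys_add[of f g] unfolding monomial_ideal_def by auto
    qed
  qed
  fix f g :: "'k mpoly"
  assume f: "f \<in> monomial_ideal t E" and g: "g \<in> carrier (poly_ring t)"
  have "g * f \<in> monomial_ideal t E"
    unfolding monomial_ideal_def
  proof safe
    show "g * f \<in> carrier (poly_ring t)"
      using f g by (auto simp: monomial_ideal_def poly_ring_closed)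
    fix \<mu> assume "\<mu> \<in> Poly_Mapping.keys (g * f)"
    then obtain \<nu> \<kappa> where "\<kappa> \<in> Poly_Mapping.keys f" "\<mu> = \<nu> + \<kappa>"
      using keys_mult[of g f] by auto
    moreover then obtain e \<rho> where "e \<in> E" "\<kappa> = e + \<rho>"
      using f by (auto simp: monomial_ideal_def)
    ultimately have "\<mu> = e + (\<rho> + \<nu>)" by (simp add: add_ac)
    then show "\<exists>e\<in>E. \<exists>\<nu>. \<mu> = e + \<nu>" using \<open>e \<in> E\<close> by blast
  qed
  then show "g \<otimes>\<^bsub>poly_ring t\<^esub> f \<in> monomial_ideal t E" "f \<otimes>\<^bsub>poly_ring t\<^esub> g \<in> monomial_ideal t E"
    by (simp_all add: mult.commute)
qed

lemma sum_singles: "(\<Sum>\<mu>\<in>Poly_Mapping.keys f. Poly_Mapping.single \<mu> (Poly_Mapping.lookup f \<mu>)) = f"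
  by (intro poly_mapping_eqI) (simp add: lookup_sum lookup_single when_def in_keys_iff)

text \<open>One inclusion is minimality of the generated ideal. For the other, a polynomial is the
  sum of its terms, each a multiple of a generator.\<close>

lemma genideal_monomials:
  assumes E: "E \<subseteq> exponents t"
  shows "Idl\<^bsub>poly_ring t\<^esub> ((\<lambda>e. Poly_Mapping.single e 1) ` E) = (monomial_ideal t E :: 'k::field mpoly set)"
    (is "Idl\<^bsub>_\<^esub> ?G = ?I")
proof
  interpret cring "poly_ring t :: 'k mpoly ring" by (rule poly_ring_cring)
  have "?G \<subseteq> ?I"
  proof safe
    fix e assume "e \<in> E"
    then have "\<exists>e'\<in>E. \<exists>\<nu>. e = e' + \<nu>"
      by (intro bexI[of _ e] exI[of _ 0]) auto
    then show "Poly_Mapping.single e 1 \<in> ?I"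
      using E \<open>e \<in> E\<close> by (auto simp: monomial_ideal_def intro: single_in_poly_ring)
  qed
  then show "Idl\<^bsub>poly_ring t\<^esub> ?G \<subseteq> ?I"
    by (intro genideal_minimal ideal_monomial_ideal)
  have G: "?G \<subseteq> carrier (poly_ring t)"
    using E by (auto intro!: single_in_poly_ring)
  interpret I: ideal "Idl\<^bsub>poly_ring t\<^esub> ?G" "poly_ring t :: 'k mpoly ring"
    using G by (rule genideal_ideal)
  show "?I \<subseteq> Idl\<^bsub>poly_ring t\<^esub> ?G"
  proof
    fix f :: "'k mpoly" assume f: "f \<in> ?I"
    have single: "Poly_Mapping.single \<mu> a \<in> Idl\<^bsub>poly_ring t\<^esub> ?G" if \<mu>: "\<mu> \<in> Poly_Mapping.keys f" for \<mu> a
    proof -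
      obtain e \<nu> where e: "e \<in> E" "\<mu> = e + \<nu>"
        using f \<mu> unfolding monomial_ideal_def by blast
      have "\<mu> \<in> exponents t" using f \<mu> by (auto simp: monomial_ideal_def carrier_poly_ring)
      then have "Poly_Mapping.single \<nu> a \<in> carrier (poly_ring t)"
        using e by (simp add: single_in_poly_ring)
      then have "Poly_Mapping.single \<nu> a \<otimes>\<^bsub>poly_ring t\<^esub> Poly_Mapping.single e 1 \<in> Idl\<^bsub>poly_ring t\<^esub> ?G"
        using genideal_self[OF G] e(1) by (intro I.I_l_closed) auto
      then show ?thesis by (simp add: mult_single e(2) add.commute)
    qed
    \<comment> \<open>Stated for partial sums, so that finite induction over the set of terms
      applies.\<close>
    have "(\<Sum>\<mu>\<in>K. Poly_Mapping.single \<mu> (Poly_Mapping.lookup f \<mu>)) \<in> Idl\<^bsub>poly_ring t\<^esub> ?G"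
      if "K \<subseteq> Poly_Mapping.keys f" "finite K" for K
      using that(2,1)
    proof (induction K)
      case empty
      then show ?case using I.zero_closed by simp
    next
      case (insert \<mu> K)
      then show ?case
        using I.a_closed[OF single[of \<mu>]] by simp
    qed
    from this[OF subset_refl] show "f \<in> Idl\<^bsub>poly_ring t\<^esub> ?G"
      by (simp add: sum_singles)
  qed
qed

lemma Const_add: "Const (a + b) = Const a + Const b"
  by (simp only: Const_def single_add)
lemma Const_mult: "Const (a * b) = Const a * Const b"
  by (simp only: Const_def mult_single add_0_left)
lemma Const_1: "Const 1 = 1"
  by (simp only: Const_def single_one)

section \<open>Quotients as vector spaces\<close>

text \<open>The class of \<open>Const a\<close> depends on \<open>a\<close> through a ring
  homomorphism, so the module axioms reduce to ring axioms of the quotient.\<close>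

lemma vectorspace_quot_space:
  assumes "ideal J (poly_ring t :: 'k::field mpoly ring)"
  shows "vectorspace class_ring (quot_space t J)"
proof -
  interpret R: cring "poly_ring t :: 'k mpoly ring" by (rule poly_ring_cring)
  interpret J: ideal J "poly_ring t" by fact
  let ?Q = "poly_ring t Quot J"
  interpret Q: cring ?Q by (rule J.quotient_is_cring[OF poly_ring_cring])
  let ?\<pi> = "\<lambda>a. J +>\<^bsub>poly_ring t\<^esub> Const a"
  have hom: "(+>\<^bsub>poly_ring t\<^esub>) J \<in> Ring.ring_hom (poly_ring t) ?Q"
    by (rule J.rcos_ring_hom)
  have closed: "?\<pi> a \<in> carrier ?Q" for a
    using ring_hom_closed[OF hom Const_in_poly_ring] .
  have add: "?\<pi> (a + b) = ?\<pi> a \<oplus>\<^bsub>?Q\<^esub> ?\<pi> b" for a b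
    using ring_hom_add[OF hom Const_in_poly_ring Const_in_poly_ring, of a b] by (simp add: Const_add)
  have mult: "?\<pi> (a * b) = ?\<pi> a \<otimes>\<^bsub>?Q\<^esub> ?\<pi> b" for a b
    using ring_hom_mult[OF hom Const_in_poly_ring Const_in_poly_ring, of a b] by (simp add: Const_mult)
  have one: "?\<pi> 1 = \<one>\<^bsub>?Q\<^esub>"
    using ring_hom_one[OF hom] by (simp add: Const_1)
  have qs: "carrier (quot_space t J) = carrier ?Q" "add (quot_space t J) = add ?Q"
    "zero (quot_space t J) = zero ?Q"
    by (simp_all only: quot_space_def partial_object.simps monoid.simps ring.simps)
  have "abelian_group (quot_space t J)"
  proof (rule abelian_groupI, unfold qs)
    fix X assume "X \<in> carrier ?Q"
    then show "\<exists>Y\<in>carrier ?Q. Y \<oplus>\<^bsub>?Q\<^esub> X = \<zero>\<^bsub>?Q\<^esub>"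
      by (intro bexI[of _ "\<ominus>\<^bsub>?Q\<^esub> X"] Q.l_neg Q.a_inv_closed)
  qed (rule Q.a_closed Q.zero_closed Q.a_assoc Q.a_comm Q.l_zero; assumption)+
  moreover have "field (class_ring :: 'k ring)" by (rule class_field)
  ultimately show ?thesis
    unfolding vectorspace_def
  proof (intro conjI moduleI)
    show "cring (class_ring :: 'k ring)" by (rule class_cring.cring_axioms)
  qed (auto simp: quot_space_def closed add mult one Q.l_distr Q.r_distr Q.m_assoc)
qed

text \<open>Reduction modulo \<open>J\<close> forgets exactly the coefficients outside
  \<open>B\<close>, so the classes of the monomials in \<open>B\<close> form a basis.\<close>

lemma dim_quot_space:
  fixes J :: "'k::field mpoly set"
  assumes ideal: "ideal J (poly_ring t)"
    and J: "J = {f \<in> carrier (poly_ring t). Poly_Mapping.keys f \<inter> B = {}}"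
    and B: "B \<subseteq> exponents t" "finite B"
  shows "vectorspace.dim class_ring (quot_space t J) = card B"
proof -
  interpret R: cring "poly_ring t :: 'k mpoly ring" by (rule poly_ring_cring)
  interpret J: ideal J "poly_ring t" by fact
  interpret V: vectorspace "class_ring :: 'k ring" "quot_space t J"
    by (rule vectorspace_quot_space[OF ideal])
  let ?Q = "poly_ring t Quot J"
  interpret Q: cring ?Q by (rule J.quotient_is_cring[OF poly_ring_cring])
  define \<pi> where "\<pi> f = J +>\<^bsub>poly_ring t\<^esub> f" for f
  interpret hom: ring_hom_cring "poly_ring t" ?Q \<pi>
    unfolding \<pi>_def by (rule J.rcos_ring_hom_cring[OF poly_ring_cring])
  define E where "E \<mu> = \<pi> (Poly_Mapping.single \<mu> 1)" for \<mu>
  have simps: "carrier (quot_space t J) = carrier ?Q" "\<zero>\<^bsub>quot_space t J\<^esub> = J"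
    "\<zero>\<^bsub>?Q\<^esub> = J" "add (quot_space t J) = add ?Q"
    by (auto simp: quot_space_def FactRing_def)
  have finsum: "finsum (quot_space t J) g A = finsum ?Q g A"
    if "finite A" "g \<in> A \<rightarrow> carrier ?Q" for g and A :: "'k mpoly set set"
    using that by (induction A) (simp_all add: simps)
  \<comment> \<open>The coefficients at \<open>B\<close> are the coordinates of a residue
    class.\<close>
  have eq_iff: "\<pi> f = \<pi> g \<longleftrightarrow> (\<forall>\<mu>\<in>B. Poly_Mapping.lookup f \<mu> = Poly_Mapping.lookup g \<mu>)"
    if "f \<in> carrier (poly_ring t)" "g \<in> carrier (poly_ring t)" for f g
  proof -
    have "\<pi> f = \<pi> g \<longleftrightarrow> f - g \<in> J"
      using that R.quotient_eq_iff_same_a_r_cos[OF ideal that]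
      by (simp add: \<pi>_def a_minus_poly_ring)
    also have "\<dots> \<longleftrightarrow> (\<forall>\<mu>\<in>B. Poly_Mapping.lookup f \<mu> = Poly_Mapping.lookup g \<mu>)"
    proof -
      have "f - g \<in> J \<longleftrightarrow> Poly_Mapping.keys (f - g) \<inter> B = {}"
        using poly_ring_closed(2)[OF that] by (subst J) simp
      also have "\<dots> \<longleftrightarrow> (\<forall>\<mu>\<in>B. Poly_Mapping.lookup (f - g) \<mu> = 0)"
        by (auto simp: in_keys_iff disjoint_iff)
      finally show ?thesis by (simp add: lookup_minus)
    qed
    finally show ?thesis .
  qed
  have single_carrier: "Poly_Mapping.single \<mu> a \<in> carrier (poly_ring t)" if "\<mu> \<in> B" for \<mu> and a :: 'k
    using that B by (auto intro: single_in_poly_ring)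
  have inj: "inj_on E B"
  proof (rule inj_onI)
    fix \<mu> \<nu> assume *: "\<mu> \<in> B" "\<nu> \<in> B" "E \<mu> = E \<nu>"
    then have "Poly_Mapping.lookup (Poly_Mapping.single \<mu> (1::'k)) \<mu> = Poly_Mapping.lookup (Poly_Mapping.single \<nu> 1) \<mu>"
      using eq_iff[OF single_carrier single_carrier] unfolding E_def by blast
    then show "\<mu> = \<nu>" by (auto simp: lookup_single when_def split: if_splits)
  qed
  have E_carrier: "E ` B \<subseteq> carrier ?Q"
    using single_carrier by (auto simp: E_def)
  have sum_carrier: "(\<Sum>\<mu>\<in>B. Poly_Mapping.single \<mu> (a \<mu> :: 'k)) \<in> carrier (poly_ring t)" for a
    using finsum_poly_ring[OF B(2), of "\<lambda>\<mu>. Poly_Mapping.single \<mu> (a \<mu>)" t]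
      R.finsum_closed[of "\<lambda>\<mu>. Poly_Mapping.single \<mu> (a \<mu>)" B] single_carrier by auto
  have lookup_sum': "Poly_Mapping.lookup (\<Sum>\<mu>\<in>B. Poly_Mapping.single \<mu> (a \<mu>)) \<nu> = a \<nu>"
    if "\<nu> \<in> B" for a :: "_ \<Rightarrow> 'k" and \<nu>
    using that B by (simp add: lookup_sum lookup_single when_def)
  have lincomb: "V.lincomb a (E ` B) = \<pi> (\<Sum>\<mu>\<in>B. Poly_Mapping.single \<mu> (a (E \<mu>)))" for a
  proof -
    have smult: "a (E \<mu>) \<odot>\<^bsub>quot_space t J\<^esub> E \<mu> = \<pi> (Poly_Mapping.single \<mu> (a (E \<mu>)))" if "\<mu> \<in> B" for \<mu>
    proof -
      have "\<pi> (Const (a (E \<mu>)) \<otimes>\<^bsub>poly_ring t\<^esub> Poly_Mapping.single \<mu> 1) = \<pi> (Const (a (E \<mu>))) \<otimes>\<^bsub>?Q\<^esub> E \<mu>"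
        unfolding E_def by (rule hom.hom_mult[OF Const_in_poly_ring single_carrier[OF that]])
      then show ?thesis
        by (simp add: quot_space_def \<pi>_def[symmetric] Const_def mult_single)
    qed
    have "V.lincomb a (E ` B) = (\<Oplus>\<^bsub>?Q\<^esub>v\<in>E ` B. a v \<odot>\<^bsub>quot_space t J\<^esub> v)"
      unfolding V.lincomb_def using B single_carrier by (intro finsum) (auto simp: smult)
    also have "\<dots> = (\<Oplus>\<^bsub>?Q\<^esub>\<mu>\<in>B. a (E \<mu>) \<odot>\<^bsub>quot_space t J\<^esub> E \<mu>)"
      using inj single_carrier by (intro Q.finsum_reindex) (auto simp: smult)
    also have "\<dots> = (\<Oplus>\<^bsub>?Q\<^esub>\<mu>\<in>B. \<pi> (Poly_Mapping.single \<mu> (a (E \<mu>))))"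
      using single_carrier by (intro Q.finsum_cong') (auto simp: smult)
    also have "\<dots> = \<pi> (finsum (poly_ring t) (\<lambda>\<mu>. Poly_Mapping.single \<mu> (a (E \<mu>))) B)"
      using single_carrier by (subst hom.hom_finsum) (auto simp: comp_def)
    also have "\<dots> = \<pi> (\<Sum>\<mu>\<in>B. Poly_Mapping.single \<mu> (a (E \<mu>)))"
      using single_carrier B by (subst finsum_poly_ring) auto
    finally show ?thesis .
  qed
  have "V.lin_indpt (E ` B)"
  proof (rule V.finite_lin_indpt2)
    show "\<forall>v\<in>E ` B. a v = \<zero>\<^bsub>class_ring\<^esub>" if "V.lincomb a (E ` B) = \<zero>\<^bsub>quot_space t J\<^esub>" for a
    proof -
      have "\<pi> (\<Sum>\<mu>\<in>B. Poly_Mapping.single \<mu> (a (E \<mu>))) = \<pi> 0"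
        using that hom.hom_zero by (simp add: lincomb simps)
      then have "Poly_Mapping.lookup (\<Sum>\<mu>\<in>B. Poly_Mapping.single \<mu> (a (E \<mu>))) \<mu> = 0" if "\<mu> \<in> B" for \<mu>
        using eq_iff[OF sum_carrier R.zero_closed] that by simp
      then show ?thesis by (simp add: lookup_sum')
    qed
  qed (use B E_carrier in \<open>auto simp: simps\<close>)
  moreover have "V.gen_set (E ` B)"
  proof
    show "V.span (E ` B) \<subseteq> carrier (quot_space t J)"
      using E_carrier by (intro V.span_is_subset2) (simp add: simps)
    show "carrier (quot_space t J) \<subseteq> V.span (E ` B)"
    proof
      fix X assume "X \<in> carrier (quot_space t J)"
      then obtain f where f: "f \<in> carrier (poly_ring t)" "X = \<pi> f"
        by (auto simp: simps FactRing_def A_RCOSETS_def' \<pi>_def)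
      \<comment> \<open>Coordinates of the class of \<open>f\<close>: each basis vector receives the
        coefficient of \<open>f\<close> at its monomial.\<close>
      define a where "a v = Poly_Mapping.lookup f (inv_into B E v)" for v
      have "X = V.lincomb a (E ` B)"
        unfolding lincomb f(2)
        by (subst eq_iff[OF f(1) sum_carrier]) (simp add: lookup_sum' a_def inv_into_f_f[OF inj])
      then show "X \<in> V.span (E ` B)"
        using B by (auto simp: V.span_def intro!: exI[of _ a] exI[of _ "E ` B"])
    qed
  qed
  ultimately have "V.basis (E ` B)"
    using E_carrier by (simp add: V.basis_def simps)
  then show ?thesis
    using V.dim_basis[of "E ` B"] B card_image[OF inj] by simp
qed

section \<open>Standard monomials of \<open>J_ideal H\<close>\<close>

lemma Var_power: "Var p ^ k = (Poly_Mapping.single (Poly_Mapping.single p k) 1 :: 'k::field mpoly)"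
  by (induction k) (simp_all add: Var_def mult_single flip: single_add)

lemma exponent_dvd_iff:
  fixes \<mu> e :: "nat \<Rightarrow>\<^sub>0 nat"
  shows "(\<exists>\<nu>. \<mu> = e + \<nu>) \<longleftrightarrow> (\<forall>x. Poly_Mapping.lookup e x \<le> Poly_Mapping.lookup \<mu> x)"
proof
  assume *: "\<forall>x. Poly_Mapping.lookup e x \<le> Poly_Mapping.lookup \<mu> x"
  \<comment> \<open>Subtraction of exponents truncates, but the assumption makes it exact
    here.\<close>
  have "\<mu> = e + (\<mu> - e)"
    by (rule poly_mapping_eqI) (simp add: lookup_add lookup_minus *)
  then show "\<exists>\<nu>. \<mu> = e + \<nu>" by blast
qed (auto simp: lookup_add)

lemma single_exponent_dvd_iff:
  "(\<exists>\<nu>. \<mu> = Poly_Mapping.single p k + \<nu>) \<longleftrightarrow> k \<le> Poly_Mapping.lookup \<mu> p"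
  for \<mu> :: "nat \<Rightarrow>\<^sub>0 nat"
  by (auto simp: exponent_dvd_iff lookup_single when_def)

lemma two_exponents_dvd_iff:
  "p \<noteq> q \<Longrightarrow> (\<exists>\<nu>. \<mu> = Poly_Mapping.single p k + Poly_Mapping.single q l + \<nu>) \<longleftrightarrow>
    k \<le> Poly_Mapping.lookup \<mu> p \<and> l \<le> Poly_Mapping.lookup \<mu> q"
  for \<mu> :: "nat \<Rightarrow>\<^sub>0 nat"
  unfolding exponent_dvd_iff
  by (auto simp: lookup_single lookup_add when_def dest: spec[of _ p] spec[of _ q])

definition J_exponents :: "nat mat \<Rightarrow> (nat \<Rightarrow>\<^sub>0 nat) set" where
  "J_exponents H =
    {Poly_Mapping.single p (H $$ (p, p)) | p. p < dim_row H} \<union>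
    {Poly_Mapping.single p (H $$ (p, p) - H $$ (p, q)) + Poly_Mapping.single q (H $$ (q, q) - H $$ (p, q))
      | p q. p < q \<and> q < dim_row H}"

lemma J_gens_eq: "J_gens H = ((\<lambda>e. Poly_Mapping.single e 1) ` J_exponents H :: 'k::field mpoly set)"
  unfolding J_gens_def J_exponents_def image_Un Var_power mult_single mult_1_left by blast

lemma J_exponents_subset: "J_exponents H \<subseteq> exponents (dim_row H)"
  by (auto simp: J_exponents_def exponents_def split: if_splits dest!: subsetD[OF keys_add])

text \<open>The standard monomials of \<open>J_ideal H\<close>, whose classes form a basis of the
  quotient.\<close>

definition std_exponents :: "nat mat \<Rightarrow> (nat \<Rightarrow>\<^sub>0 nat) set" where
  "std_exponents H = {\<mu> \<in> exponents (dim_row H). \<forall>e\<in>J_exponents H. \<nexists>\<nu>. \<mu> = e + \<nu>}"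

lemma std_exponents_iff:
  "\<mu> \<in> std_exponents H \<longleftrightarrow> \<mu> \<in> exponents (dim_row H) \<and>
    (\<forall>p<dim_row H. Poly_Mapping.lookup \<mu> p < H $$ (p, p)) \<and>
    (\<forall>p q. p < q \<and> q < dim_row H \<longrightarrow>
      Poly_Mapping.lookup \<mu> p < H $$ (p, p) - H $$ (p, q) \<or> Poly_Mapping.lookup \<mu> q < H $$ (q, q) - H $$ (p, q))"
proof -
  have "(\<forall>e\<in>J_exponents H. \<nexists>\<nu>. \<mu> = e + \<nu>) \<longleftrightarrow>
    (\<forall>p<dim_row H. \<nexists>\<nu>. \<mu> = Poly_Mapping.single p (H $$ (p, p)) + \<nu>) \<and>
    (\<forall>p q. p < q \<and> q < dim_row H \<longrightarrow> (\<nexists>\<nu>. \<mu> = Poly_Mapping.single p (H $$ (p, p) - H $$ (p, q))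
      + Poly_Mapping.single q (H $$ (q, q) - H $$ (p, q)) + \<nu>))"
    unfolding J_exponents_def by blast
  also have "\<dots> \<longleftrightarrow> (\<forall>p<dim_row H. Poly_Mapping.lookup \<mu> p < H $$ (p, p)) \<and>
    (\<forall>p q. p < q \<and> q < dim_row H \<longrightarrow>
      Poly_Mapping.lookup \<mu> p < H $$ (p, p) - H $$ (p, q) \<or> Poly_Mapping.lookup \<mu> q < H $$ (q, q) - H $$ (p, q))"
    unfolding single_exponent_dvd_iff by (simp add: two_exponents_dvd_iff not_le de_Morgan_conj)
  finally show ?thesis by (simp add: std_exponents_def)
qed

text \<open>The map reflects each coordinate of the box, turning
  \<open>\<mu> p < H $$ (p, p) - H $$ (p, q)\<close> into \<open>H $$ (p, q) \<le> u p\<close>.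
  Reflecting twice gives the identity.\<close>

lemma bij_betw_std_exponents:
  assumes sym: "\<And>p q. p < dim_row H \<Longrightarrow> q < dim_row H \<Longrightarrow> H $$ (p, q) = H $$ (q, p)"
  shows "bij_betw (\<lambda>\<mu>. \<lambda>p\<in>{..<dim_row H}. H $$ (p, p) - 1 - Poly_Mapping.lookup \<mu> p)
    (std_exponents H) (free_set (\<lambda>p q. H $$ (p, q)) {..<dim_row H})"
    (is "bij_betw ?\<phi> _ (free_set ?h ?T)")
proof -
  \<comment> \<open>The same reflection in the other direction, with exponent zero outside the
    variables of the ring.\<close>
  define \<psi> :: "(nat \<Rightarrow> nat) \<Rightarrow> nat \<Rightarrow>\<^sub>0 nat" where
    "\<psi> u = (\<Sum>p\<in>?T. Poly_Mapping.single p (H $$ (p, p) - 1 - u p))" for u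
  have lookup_\<psi>: "Poly_Mapping.lookup (\<psi> u) p = (if p < dim_row H then H $$ (p, p) - 1 - u p else 0)" for u p
    by (simp add: \<psi>_def lookup_sum lookup_single when_def)
  have exp_\<psi>: "\<psi> u \<in> exponents (dim_row H)" for u
    by (auto simp: exponents_def in_keys_iff lookup_\<psi> split: if_splits)
  show ?thesis
  proof (rule bij_betw_byWitness[where f' = \<psi>])
    show "\<forall>\<mu>\<in>std_exponents H. \<psi> (?\<phi> \<mu>) = \<mu>"
    proof
      fix \<mu> assume \<mu>: "\<mu> \<in> std_exponents H"
      have "Poly_Mapping.lookup (\<psi> (?\<phi> \<mu>)) p = Poly_Mapping.lookup \<mu> p" for p
      proof (cases "p < dim_row H")
        case True
        then have "Poly_Mapping.lookup \<mu> p < H $$ (p, p)"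
          using \<mu> by (simp add: std_exponents_iff)
        then show ?thesis using True by (simp add: lookup_\<psi>)
      next
        case False
        then have "Poly_Mapping.lookup \<mu> p = 0"
          using \<mu> by (auto simp: std_exponents_iff exponents_def in_keys_iff subset_iff)
        then show ?thesis using False by (simp add: lookup_\<psi>)
      qed
      then show "\<psi> (?\<phi> \<mu>) = \<mu>" by (rule poly_mapping_eqI)
    qed
    show "\<forall>u\<in>free_set ?h ?T. ?\<phi> (\<psi> u) = u"
    proof
      fix u assume u: "u \<in> free_set ?h ?T"
      show "?\<phi> (\<psi> u) = u"
      proof
        \<comment> \<open>Outside the index set both sides have the default value
          \<open>undefined\<close>.\<close>
        fix p show "?\<phi> (\<psi> u) p = u p"
          using free_set_less[OF u, of p] u
          by (auto simp: lookup_\<psi> free_set_def PiE_def extensional_def)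
      qed
    qed
    show "?\<phi> ` std_exponents H \<subseteq> free_set ?h ?T"
    proof safe
      fix \<mu> assume \<mu>: "\<mu> \<in> std_exponents H"
      have less: "Poly_Mapping.lookup \<mu> p < H $$ (p, p)" if "p < dim_row H" for p
        using \<mu> that by (simp add: std_exponents_iff)
      have "?\<phi> \<mu> \<in> (\<Pi>\<^sub>E p\<in>?T. {..<?h p p})"
      proof (rule PiE_I)
        show "?\<phi> \<mu> p \<in> {..<?h p p}" if "p \<in> ?T" for p
          using less[of p] that by auto
      qed auto
      moreover have ord: "?h p q \<le> max (?\<phi> \<mu> p) (?\<phi> \<mu> q)" if "p < q" "q < dim_row H" for p q
      proof -
        have "Poly_Mapping.lookup \<mu> p < H $$ (p, p) - H $$ (p, q) \<or> Poly_Mapping.lookup \<mu> q < H $$ (q, q) - H $$ (p, q)"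
          using \<mu> that by (simp add: std_exponents_iff)
        then show ?thesis using that by auto
      qed
      \<comment> \<open>Generators are listed for \<open>p < q\<close> only; symmetry of
        \<open>H\<close> gives the other order.\<close>
      moreover have "?h p q \<le> max (?\<phi> \<mu> p) (?\<phi> \<mu> q)" if "p \<in> ?T" "q \<in> ?T" "p \<noteq> q" for p q
        using ord[of p q] ord[of q p] sym[of p q] that
        by (cases "p < q") (auto simp: max.commute)
      ultimately show "?\<phi> \<mu> \<in> free_set ?h ?T"
        by (simp add: free_set_def)
    qed
    show "\<psi> ` free_set ?h ?T \<subseteq> std_exponents H"
    proof safe
      fix u assume u: "u \<in> free_set ?h ?T"
      have less: "u p < H $$ (p, p)" if "p < dim_row H" for p
        using free_set_less[OF u, of p] that by simp
      have "Poly_Mapping.lookup (\<psi> u) p < H $$ (p, p)" if "p < dim_row H" for p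
        using less[OF that] that by (simp add: lookup_\<psi>)
      moreover have "Poly_Mapping.lookup (\<psi> u) p < H $$ (p, p) - H $$ (p, q) \<or>
          Poly_Mapping.lookup (\<psi> u) q < H $$ (q, q) - H $$ (p, q)" if "p < q" "q < dim_row H" for p q
      proof -
        have "H $$ (p, q) \<le> max (u p) (u q)"
          using u that by (auto simp: free_set_def)
        then show ?thesis
          using less[of p] less[of q] that by (auto simp: lookup_\<psi> le_max_iff_disj)
      qed
      ultimately show "\<psi> u \<in> std_exponents H"
        using exp_\<psi> by (simp add: std_exponents_iff)
    qed
  qed
qed

text \<open>\<open>dim_quot_space\<close> applies with the standard monomials as \<open>B\<close>,
  and their reflections are the points of \<open>free_set\<close>.\<close>

lemma dim_quot_J_ideal:
  assumes sym: "\<And>p q. p < dim_row H \<Longrightarrow> q < dim_row H \<Longrightarrow> H $$ (p, q) = H $$ (q, p)"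
  shows "vectorspace.dim class_ring (quot_space (dim_row H) (J_ideal H :: 'k::field mpoly set)) =
    card (free_set (\<lambda>p q. H $$ (p, q)) {..<dim_row H})"
proof -
  note bij = bij_betw_std_exponents[OF sym]
  have J: "J_ideal H = (monomial_ideal (dim_row H) (J_exponents H) :: 'k mpoly set)"
    unfolding J_ideal_def J_gens_eq by (rule genideal_monomials[OF J_exponents_subset])
  have "vectorspace.dim class_ring (quot_space (dim_row H) (J_ideal H :: 'k mpoly set)) = card (std_exponents H)"
    unfolding J
  proof (rule dim_quot_space[OF ideal_monomial_ideal])
    show "monomial_ideal (dim_row H) (J_exponents H) =
        {f \<in> carrier (poly_ring (dim_row H)). Poly_Mapping.keys f \<inter> std_exponents H = {}}"
      unfolding monomial_ideal_def std_exponents_def carrier_poly_ring by blast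
    show "std_exponents H \<subseteq> exponents (dim_row H)"
      by (auto simp: std_exponents_def)
    show "finite (std_exponents H)"
      using bij_betw_finite[OF bij] finite_free_set by blast
  qed
  then show ?thesis using bij_betw_same_card[OF bij] by simp
qed

section \<open>The equality case\<close>

theorem theorem3p9:
  fixes n m t b :: nat
    and \<alpha> \<beta> :: "nat \<Rightarrow> nat"
    and d c :: "nat \<Rightarrow> nat \<Rightarrow> nat"
    and P D C H :: "nat mat"
  assumes n: "n \<ge> 2" and m: "m \<ge> 1" and t: "t = n + m"
    and P: "P = mat n n (\<lambda>(i, j). if i = j then \<alpha> i else b)"
    and D: "D = mat n m (\<lambda>(i, j). d i j)"
    and C: "C = mat m m (\<lambda>(i, j). if i = j then \<beta> i else c i j)"
    and H: "H = four_block_mat P D (transpose_mat D) C"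
    and c_sym: "\<And>i j. i < m \<Longrightarrow> j < m \<Longrightarrow> i \<noteq> j \<Longrightarrow> c i j = c j i"
    and a: "\<And>i j. i < n \<Longrightarrow> j < m \<Longrightarrow>
      \<alpha> i \<ge> b \<and> b \<ge> 1 \<and> b \<ge> d i j \<and> d i j \<ge> 0 \<and> \<beta> j \<ge> 1 \<and> \<beta> j \<ge> d i j"
    and b: "\<And>i j. i < m \<Longrightarrow> j < m \<Longrightarrow> i \<noteq> j \<Longrightarrow> \<beta> i \<ge> c i j \<and> b \<ge> c i j"
    and c: "\<And>i j. i < n \<Longrightarrow> j < n \<Longrightarrow> i \<noteq> j \<Longrightarrow> \<alpha> i > b \<or> \<alpha> j > b"
    and d: "\<And>i j. i < m \<Longrightarrow> j < m \<Longrightarrow> i \<noteq> j \<Longrightarrow> \<beta> i > c i j \<or> \<beta> j > c i j"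
    and e: "\<And>i j. i < n \<Longrightarrow> j < m \<Longrightarrow> \<alpha> i > d i j \<or> \<beta> j > d i j"
    and f: "\<And>j. j < m \<Longrightarrow> \<exists>i<n. d i j \<noteq> b"
    and psd: "pos_semidef t (map_mat real H)"
    and dim_eq_det: "int (vectorspace.dim class_ring (quot_space t (J_ideal H :: 'k::field mpoly set)))
        = det (map_mat int H)"
  shows "\<forall>l<m. \<forall>r<n. \<forall>s<n. d r l = d s l"
proof (rule ccontr)
  assume "\<not> ?thesis"
  then obtain l r s where l: "l < m" and r: "r < n" and s: "s < n" and neq: "d r l \<noteq> d s l"
    by blast
  define h where "h p q = H $$ (p, q)" for p q
  have H_carrier: "H \<in> carrier_mat t t"
    by (simp add: H P D C t)
  have h: "h p q = (if p < n then if q < n then if p = q then \<alpha> p else b else d p (q - n)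
      else if q < n then d q (p - n) else if p = q then \<beta> (p - n) else c (p - n) (q - n))"
    if "p < t" "q < t" for p q
    using that by (auto simp: h_def H P D C t)
  have blocks: thesis if "p < t" and "p < n \<Longrightarrow> thesis" and "\<And>i. p = n + i \<Longrightarrow> i < m \<Longrightarrow> thesis" for p thesis
    using that by (metis add_less_cancel_left le_add_diff_inverse not_le t)
  have sym: "h p q = h q p" if "p < t" "q < t" for p q
    using that c_sym by (auto simp: h t)
  have dom: "h p q \<le> h p p" and pos: "0 < h p p"
    and strict: "p \<noteq> q \<Longrightarrow> h p q < h p p \<or> h p q < h q q" if p: "p < t" and q: "q < t" for p q
  proof -
    \<comment> \<open>Assumptions \<open>a\<close> and \<open>b\<close> give the maximal and
      positive diagonal; \<open>c\<close>, \<open>d\<close> and \<open>e\<close> give the strict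
      alternatives for the three kinds of pairs.\<close>
    have "h p q \<le> h p p \<and> 0 < h p p \<and> (p \<noteq> q \<longrightarrow> h p q < h p p \<or> h p q < h q q)"
    proof (rule blocks[OF p]; rule blocks[OF q])
      assume "p < n" "q < n"
      \<comment> \<open>Index \<open>0\<close> of the second block exists by
        \<open>m \<ge> 1\<close> and serves to instantiate \<open>a\<close>.\<close>
      then show ?thesis using a[of p 0] c[of p q] m p q by (auto simp: h)
    next
      fix j assume "p < n" "q = n + j" "j < m"
      then show ?thesis using a[of p j] e[of p j] p q by (auto simp: h)
    next
      fix i assume "p = n + i" "i < m" "q < n"
      then show ?thesis using a[of q i] e[of q i] p q by (auto simp: h)
    next
      fix i j assume "p = n + i" "i < m" "q = n + j" "j < m"
      then show ?thesis using a[of 0 i] b[of i j] d[of i j] n p q by (auto simp: h)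
    qed
    then show "h p q \<le> h p p" "0 < h p p" "p \<noteq> q \<Longrightarrow> h p q < h p p \<or> h p q < h q q" by auto
  qed
  have "r \<noteq> s" using neq by auto
  have rs: "r < t" "s < t" using r s t by auto
  obtain xs where dist_xs: "distinct xs" and xs: "set xs = {..<t} - {r, s}"
    using finite_distinct_list[of "{..<t} - {r, s}"] by auto
  have dist: "distinct (r # s # xs)"
    using dist_xs xs \<open>r \<noteq> s\<close> by simp
  have set: "set (r # s # xs) = {..<t}"
    unfolding list.set xs using rs by auto
  have "psd_on (\<lambda>p q. map_mat real H $$ (p, q)) {..<t}"
    using psd by (rule psd_on_of_pos_semidef)
  moreover have "map_mat real H $$ (p, q) = real (h p q)" if "p < t" "q < t" for p q
    using that H_carrier by (simp add: h_def)
  ultimately have psd': "psd_on (\<lambda>p q. real (h p q)) {..<t}"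
    using blf_cong[of "{..<t}" "\<lambda>p q. map_mat real H $$ (p, q)" "\<lambda>p q. real (h p q)"]
    by (auto simp: psd_on_def)
  \<comment> \<open>The entry at \<open>r\<close>, \<open>s\<close> is \<open>b\<close>, which by
    \<open>a\<close> bounds every off-diagonal entry of the first \<open>n\<close> rows.\<close>
  have max: "h r q \<le> h r s \<and> h s q \<le> h r s" if "q \<in> set xs" for q
  proof -
    have q: "q < t" "q \<noteq> r" "q \<noteq> s" using that xs by auto
    show ?thesis
      by (rule blocks[OF q(1)]) (use q rs r s \<open>r \<noteq> s\<close> a in \<open>auto simp: h\<close>)
  qed
  \<comment> \<open>Column \<open>l\<close> of \<open>D\<close> sits at index \<open>n + l\<close>,
    where the rows \<open>r\<close> and \<open>s\<close> differ.\<close>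
  have ex: "\<exists>q\<in>set xs. h r q \<noteq> h s q"
  proof
    show "h r (n + l) \<noteq> h s (n + l)" using r s l neq rs by (simp add: h t)
    show "n + l \<in> set xs" using r s l t xs by auto
  qed
  have N_pos: "0 < card (free_set h {..<t})"
    using pos strict by (intro free_set_pos) auto
  have "det (mat_on (\<lambda>p q. real (h p q)) (r # s # xs)) < card (free_set h (set (r # s # xs)))"
  proof (rule det_le_card_step(2)[OF dist _ _ _ _ ex])
    show "h r q \<le> h r s \<and> h s q \<le> h r s" if "q \<in> set xs" for q
      using that by (rule max)
    show "psd_on (\<lambda>p q. real (h p q)) (set (r # s # xs))" "0 < card (free_set h (set (r # s # xs)))"
      unfolding set by (fact psd' N_pos)+
    show "h p q \<le> h p p" if "p \<in> set (r # s # xs)" "q \<in> set (r # s # xs)" for p q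
      using that unfolding set by (simp add: dom)
    \<comment> \<open>The induction hypothesis of the step is by now a theorem.\<close>
    show "det (mat_on (\<lambda>p q. real (h' p q)) ys) \<le> card (free_set h' (set ys))"
      if "distinct ys" "psd_on (\<lambda>p q. real (h' p q)) (set ys)"
        "\<And>p q. p \<in> set ys \<Longrightarrow> q \<in> set ys \<Longrightarrow> h' p q \<le> h' p p"
      for h' :: "nat \<Rightarrow> nat \<Rightarrow> nat" and ys
      using that by (rule det_le_card_free_set)
  qed
  moreover have "mset (r # s # xs) = mset [0..<t]"
    using dist set set_eq_iff_mset_eq_distinct[of "r # s # xs" "[0..<t]"] by (simp add: atLeast0LessThan)
  then have "det (mat_on (\<lambda>p q. real (h p q)) (r # s # xs)) = det (mat_on (\<lambda>p q. real (h p q)) [0..<t])"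
    by (rule det_mat_on_mset)
  ultimately have "det (mat_on (\<lambda>p q. real (h p q)) [0..<t]) < card (free_set h {..<t})"
    unfolding set by simp
  moreover have "mat_on (\<lambda>p q. real (h p q)) [0..<t] = map_mat real_of_int (map_mat int H)"
    using H_carrier by (intro eq_matI) (auto simp: mat_on_def h_def)
  moreover have "vectorspace.dim class_ring (quot_space t (J_ideal H :: 'k mpoly set)) = card (free_set h {..<t})"
    using dim_quot_J_ideal[of H] H_carrier sym by (simp add: h_def[abs_def])
  \<comment> \<open>The integer determinant is compared with the real one through the embedding,
    which commutes with \<open>det\<close>.\<close>
  ultimately show False
    using dim_eq_det of_int_hom.hom_det[of "map_mat int H", where 'a = real]
    by simp
qed

end
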